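(* Let $G=(L,R,E)$ be a finite simple bipartite graph with $L=\{u_1,\dots,u_l\}$, $R=\{v_1,\dots,v_r\}$, $V=L\cup R$, all edges directed from $L$ to $R$. Let $(c_1,\dots,c_l)$ and $(a_1,\dots,a_r)$ be vectors of non-negative integers such that $\deg^+_G(u_i)\ge c_i$ for all $u_i\in L$ and $\sum_{i=1}^l c_i=\sum_{j=1}^r a_j$. Let $\mathcal N$ be the flow network associated with $(G,\{c_i\}_{i=1}^l,\{a_j\}_{j=1}^r)$ described in the context. Then the minimum cost of a feasible flow in $\mathcal N$ equals $\text{MIN-DISCREPANCY}(G,\{c_i\}_{i=1}^l,\{a_j\}_{j=1}^r)$, and it can be computed in $O(|E||V|^2\log(|V|))$ time.
   Context: Discrepancy problem: a subgraph $H$ of $G$ (on the same vertex set, with edge set a subset of $E$) is a feasible solution if $\deg_H^+(u_i)=c_i$ for all $u_i\in L$. Its discrepancy from the target in-degree distribution $(a_1,\dots,a_r)$ is $f(H)=\sum_{v_j\in R}|\deg_H^-(v_j)-a_j|$. $\text{MIN-DISCREPANCY}(G,\{c_i\}_{i=1}^l,\{a_j\}_{j=1}^r)$ denotes the minimum of $f(H)$ over all feasible solutions $H$. Flow network $\mathcal N$: its nodes are a copy of each node of $G$ together with two special nodes $t_1,t_2$. Each $u_i\in L$ has supply $c_i$, the node $t_2$ has demand $\sum_{j=1}^r a_j=\sum_{i=1}^l c_i$, and all other nodes have zero supply and demand. The arcs are: - for each edge $(u_i,v_j)\in E$, an arc $(u_i,v_j)$ with capacity $1$ and cost $0$; - for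 each $v_j\in R$, an arc $(v_j,t_1)$ with capacity $a_j$ and cost $0$; - for each $v_j\in R$, an arc $(v_j,t_2)$ with infinite capacity and cost $2$ per unit of flow; - an arc $(t_1,t_2)$ with infinite capacity and cost $0$. *)

theory Defs
  imports Complex_Main "HOL-Library.Extended_Real"
begin

section \<open>Bipartite graphs and the discrepancy problem\<close>

text \<open>The vertices \<open>u\<^sub>i\<close> and \<open>v\<^sub>j\<close> are \<open>U i\<close> and \<open>V j\<close>, with indices starting at 1. An edge \<open>(x, y)\<close> is
  directed from \<open>x\<close> to \<open>y\<close>.\<close>

datatype vertex = U nat | V nat

definition left_vertices :: "nat \<Rightarrow> vertex set" where
  "left_vertices l = U ` {1..l}"

definition right_vertices :: "nat \<Rightarrow> vertex set" where
  "right_vertices r = V ` {1..r}"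

definition out_deg :: "(vertex \<times> vertex) set \<Rightarrow> vertex \<Rightarrow> nat" where
  "out_deg H x = card {y. (x, y) \<in> H}"

definition in_deg :: "(vertex \<times> vertex) set \<Rightarrow> vertex \<Rightarrow> nat" where
  "in_deg H y = card {x. (x, y) \<in> H}"

locale discrepancy_instance =
  fixes l r :: nat
    and E :: "(vertex \<times> vertex) set"
    and c a :: "nat \<Rightarrow> nat"
  assumes edges: "E \<subseteq> left_vertices l \<times> right_vertices r"
    and out_deg_ge: "\<forall>i\<in>{1..l}. out_deg E (U i) \<ge> c i"
    and sum_eq: "(\<Sum>i=1..l. c i) = (\<Sum>j=1..r. a j)"

text \<open>A subgraph on the full vertex set is given by its edge set.\<close>

definition feasible_solution ::
  "nat \<Rightarrow> (vertex \<times> vertex) set \<Rightarrow> (nat \<Rightarrow> nat) \<Rightarrow> (vertex \<times> vertex) set \<Rightarrow> bool" where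
  "feasible_solution l E c H \<longleftrightarrow> H \<subseteq> E \<and> (\<forall>i\<in>{1..l}. out_deg H (U i) = c i)"

definition discrepancy :: "nat \<Rightarrow> (nat \<Rightarrow> nat) \<Rightarrow> (vertex \<times> vertex) set \<Rightarrow> int" where
  "discrepancy r a H = (\<Sum>j=1..r. \<bar>int (in_deg H (V j)) - int (a j)\<bar>)"

definition min_discrepancy ::
  "nat \<Rightarrow> nat \<Rightarrow> (vertex \<times> vertex) set \<Rightarrow> (nat \<Rightarrow> nat) \<Rightarrow> (nat \<Rightarrow> nat) \<Rightarrow> int" where
  "min_discrepancy l r E c a = Min (discrepancy r a ` {H. feasible_solution l E c H})"


section \<open>Minimum cost flows\<close>

text \<open>\<open>balance\<close> is supply minus demand.\<close>

record 'n flow_network =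
  nodes :: "'n set"
  arcs :: "('n \<times> 'n) set"
  capacity :: "'n \<times> 'n \<Rightarrow> ereal"
  cost :: "'n \<times> 'n \<Rightarrow> real"
  balance :: "'n \<Rightarrow> real"

definition feasible_flow :: "'n flow_network \<Rightarrow> ('n \<times> 'n \<Rightarrow> real) \<Rightarrow> bool" where
  "feasible_flow N f \<longleftrightarrow>
     (\<forall>e\<in>arcs N. 0 \<le> f e \<and> ereal (f e) \<le> capacity N e) \<and>
     (\<forall>x\<in>nodes N.
        (\<Sum>e\<in>{e \<in> arcs N. fst e = x}. f e) - (\<Sum>e\<in>{e \<in> arcs N. snd e = x}. f e) = balance N x)"

definition flow_cost :: "'n flow_network \<Rightarrow> ('n \<times> 'n \<Rightarrow> real) \<Rightarrow> real" where
  "flow_cost N f = (\<Sum>e\<in>arcs N. cost N e * f e)"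

definition is_min_flow_cost :: "'n flow_network \<Rightarrow> real \<Rightarrow> bool" where
  "is_min_flow_cost N m \<longleftrightarrow>
     (\<exists>f. feasible_flow N f \<and> flow_cost N f = m) \<and>
     (\<forall>f. feasible_flow N f \<longrightarrow> m \<le> flow_cost N f)"

datatype node = Copy vertex | T1 | T2

text \<open>The values of \<open>capacity\<close> and \<open>cost\<close> outside the set of arcs are irrelevant.\<close>

definition discrepancy_network ::
  "nat \<Rightarrow> nat \<Rightarrow> (vertex \<times> vertex) set \<Rightarrow> (nat \<Rightarrow> nat) \<Rightarrow> (nat \<Rightarrow> nat) \<Rightarrow> node flow_network" where
  "discrepancy_network l r E c a =
    \<lparr> nodes = Copy ` (left_vertices l \<union> right_vertices r) \<union> {T1, T2},
      arcs = {(Copy x, Copy y) | x y. (x, y) \<in> E}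
        \<union> {(Copy y, T1) | y. y \<in> right_vertices r}
        \<union> {(Copy y, T2) | y. y \<in> right_vertices r}
        \<union> {(T1, T2)},
      capacity = (\<lambda>e. case e of
          (Copy _, Copy _) \<Rightarrow> 1
        | (Copy (V j), T1) \<Rightarrow> ereal (real (a j))
        | _ \<Rightarrow> \<infinity>),
      cost = (\<lambda>e. case e of (Copy (V j), T2) \<Rightarrow> 2 | _ \<Rightarrow> 0),
      balance = (\<lambda>x. case x of
          Copy (U i) \<Rightarrow> real (c i)
        | T2 \<Rightarrow> - real (\<Sum>j=1..r. a j)
        | _ \<Rightarrow> 0) \<rparr>"


section \<open>Machine model for the running time\<close>

text \<open>
  Running time is measured on a unit-cost random access machine over the natural numbers, programmed
  with structured control flow. A state consists of registers and of a memory with indirect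
  addressing. Arithmetic is restricted to addition and truncated subtraction, as unit-cost
  multiplication would allow unreasonably long numbers to be produced in few steps. Asymptotic time
  bounds are stated with an additive constant 1 in the bounding function, because
  \<open>|E| |V|\<^sup>2 log |V|\<close> is 0 for a graph without edges whereas every program takes at least one step;
  whenever there is an edge, this summand can be absorbed into the constant factor.
\<close>

type_synonym state = "(nat \<Rightarrow> nat) \<times> (nat \<Rightarrow> nat)"

datatype exp = Const nat | Reg nat | Mem exp | Plus exp exp | Minus exp exp

fun eval :: "exp \<Rightarrow> state \<Rightarrow> nat" where
  "eval (Const n) s = n"
| "eval (Reg x) s = fst s x"
| "eval (Mem e) s = snd s (eval e s)"
| "eval (Plus e1 e2) s = eval e1 s + eval e2 s"
| "eval (Minus e1 e2) s = eval e1 s - eval e2 s"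

fun eval_time :: "exp \<Rightarrow> nat" where
  "eval_time (Const n) = 1"
| "eval_time (Reg x) = 1"
| "eval_time (Mem e) = eval_time e + 1"
| "eval_time (Plus e1 e2) = eval_time e1 + eval_time e2 + 1"
| "eval_time (Minus e1 e2) = eval_time e1 + eval_time e2 + 1"

text \<open>In \<open>Cond\<close> and \<open>While\<close>, a nonzero value of the expression counts as true.\<close>

datatype com =
    Skip
  | Assign nat exp
  | Store exp exp
  | Seq com com
  | Cond exp com com
  | While exp com

text \<open>\<open>exec p s t s'\<close>: started in state \<open>s\<close>, the program \<open>p\<close> halts in state \<open>s'\<close> after \<open>t\<close> time units.\<close>

inductive exec :: "com \<Rightarrow> state \<Rightarrow> nat \<Rightarrow> state \<Rightarrow> bool" where
  exec_Skip: "exec Skip s 1 s"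
| exec_Assign: "exec (Assign x e) s (eval_time e + 1) ((fst s)(x := eval e s), snd s)"
| exec_Store: "exec (Store e1 e2) s (eval_time e1 + eval_time e2 + 1)
    (fst s, (snd s)(eval e1 s := eval e2 s))"
| exec_Seq: "\<lbrakk>exec p s t s'; exec q s' t' s''\<rbrakk> \<Longrightarrow> exec (Seq p q) s (t + t') s''"
| exec_Cond_True: "\<lbrakk>eval e s \<noteq> 0; exec p s t s'\<rbrakk> \<Longrightarrow>
    exec (Cond e p q) s (eval_time e + 1 + t) s'"
| exec_Cond_False: "\<lbrakk>eval e s = 0; exec q s t s'\<rbrakk> \<Longrightarrow>
    exec (Cond e p q) s (eval_time e + 1 + t) s'"
| exec_While_False: "eval e s = 0 \<Longrightarrow> exec (While e p) s (eval_time e + 1) s"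
| exec_While_True: "\<lbrakk>eval e s \<noteq> 0; exec p s t s'; exec (While e p) s' t' s''\<rbrakk> \<Longrightarrow>
    exec (While e p) s (eval_time e + 1 + t + t') s''"

lemma exec_deterministic:
  "exec p s t s' \<Longrightarrow> exec p s t2 s2 \<Longrightarrow> t2 = t \<and> s2 = s'"
proof (induction arbitrary: t2 s2 rule: exec.induct)
  case (exec_Seq p s t s' q t' s'')
  from exec_Seq.prems obtain u v m where
    "exec p s u m" "exec q m v s2" "t2 = u + v"
    by (cases rule: exec.cases) blast
  with exec_Seq.IH show ?case by blast
next
  case (exec_Cond_True e s p t s' q)
  from exec_Cond_True.prems exec_Cond_True.hyps(1) obtain u where
    "exec p s u s2" "t2 = eval_time e + 1 + u"
    by (cases rule: exec.cases) blast+
  with exec_Cond_True.IH show ?case by blast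
next
  case (exec_Cond_False e s q t s' p)
  from exec_Cond_False.prems exec_Cond_False.hyps(1) obtain u where
    "exec q s u s2" "t2 = eval_time e + 1 + u"
    by (cases rule: exec.cases) blast+
  with exec_Cond_False.IH show ?case by blast
next
  case (exec_While_True e s p t s' t' s'')
  from exec_While_True.prems exec_While_True.hyps(1) obtain u v m where
    "exec p s u m" "exec (While e p) m v s2" "t2 = eval_time e + 1 + u + v"
    by (cases rule: exec.cases) blast+
  with exec_While_True.IH show ?case by blast
qed (erule exec.cases; blast)+

text \<open>
  The input consists of the numbers of left vertices, right vertices and edges, followed by
  \<open>c\<^sub>1, \<dots>, c\<^sub>l\<close>, by \<open>a\<^sub>1, \<dots>, a\<^sub>r\<close> and by the endpoints of the edges, which are listed in arbitrary order.
  It is placed at the start of the memory; all other cells and all registers are initially 0.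
  The result is expected in register 0.
\<close>

definition edge_set :: "(nat \<times> nat) list \<Rightarrow> (vertex \<times> vertex) set" where
  "edge_set es = (\<lambda>(i, j). (U i, V j)) ` set es"

definition input_list ::
  "nat \<Rightarrow> nat \<Rightarrow> (nat \<times> nat) list \<Rightarrow> (nat \<Rightarrow> nat) \<Rightarrow> (nat \<Rightarrow> nat) \<Rightarrow> nat list" where
  "input_list l r es c a =
     [l, r, length es] @ map c [1..<Suc l] @ map a [1..<Suc r] @ concat (map (\<lambda>(i, j). [i, j]) es)"

definition initial_state :: "nat list \<Rightarrow> state" where
  "initial_state xs = (\<lambda>_. 0, \<lambda>k. if k < length xs then xs ! k else 0)"

definition result :: "state \<Rightarrow> nat" where
  "result s = fst s 0"

end

(* A set F of edges has excess c i - out_deg at U i and in_deg - a j at V j. If F respects the c i, any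
   extension of F to a feasible solution has discrepancy at most twice the total positive excess. If some
   vertex set S contains all vertices of positive excess, none of negative excess, and no residual arc
   leaves it, then S is a cut showing that every flow costs at least twice that excess. Such an F is
   therefore optimal for both problems at once.

   A push-relabel algorithm that stops raising labels at n = l + r finds F and S: each push moves a unit
   along one edge, a potential bounded by 3 n |E| increases with every push and relabelling, and a step
   costs O(n) with a residual matrix in memory, so that O(|E| n^2) suffices. *)
theory Submission
  imports Defs
begin

section \<open>Cut certificates\<close>

text \<open>The minimum is over real-valued flows, but no integrality theorem is needed: the lower
  bound is weak duality for the linear program, and an integral object, the completed graph, attains
  it. Excess that cannot reach a deficit may stay where it is, because both the extension bound and
  the cut bound depend only on its total.

  The delicate point of the running time is a graph with many isolated vertices. Up to n
  relabellings of each of n vertices at O(n) apiece would cost n^3, which |E| n^2 does not dominate.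
  Only endpoints of edges can have positive excess, and there are at most 2 |E| of them. Their
  labels, together with one label per edge, account for the factor 3 in the potential bound.

  The machine has no multiplication, so the address of a matrix row is found by repeated addition.
  This costs O(n), which is no more than searching the row.\<close>

definition excess :: "(nat \<Rightarrow> nat) \<Rightarrow> (nat \<Rightarrow> nat) \<Rightarrow> (vertex \<times> vertex) set \<Rightarrow> vertex \<Rightarrow> int" where
  "excess c a F v = (case v of
      U i \<Rightarrow> int (c i) - int (out_deg F v)
    | V j \<Rightarrow> int (in_deg F v) - int (a j))"

definition total_excess ::
  "nat \<Rightarrow> nat \<Rightarrow> (nat \<Rightarrow> nat) \<Rightarrow> (nat \<Rightarrow> nat) \<Rightarrow> (vertex \<times> vertex) set \<Rightarrow> int" where
  "total_excess l r c a F = (\<Sum>v\<in>left_vertices l \<union> right_vertices r. max 0 (excess c a F v))"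

text \<open>These are the complementary slackness conditions between F and the dual solution that is
  2 on S and 0 elsewhere: edges leaving S are saturated and edges entering S are empty.\<close>

definition cut_certificate ::
  "nat \<Rightarrow> nat \<Rightarrow> (vertex \<times> vertex) set \<Rightarrow> (nat \<Rightarrow> nat) \<Rightarrow> (nat \<Rightarrow> nat) \<Rightarrow>
    (vertex \<times> vertex) set \<Rightarrow> vertex set \<Rightarrow> bool" where
  "cut_certificate l r E c a F S \<longleftrightarrow>
     F \<subseteq> E \<and>
     (\<forall>i\<in>{1..l}. out_deg F (U i) \<le> c i) \<and>
     (\<forall>x y. (x, y) \<in> E - F \<longrightarrow> x \<in> S \<longrightarrow> y \<in> S) \<and>
     (\<forall>x y. (x, y) \<in> F \<longrightarrow> y \<in> S \<longrightarrow> x \<in> S) \<and>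
     (\<forall>v\<in>left_vertices l \<union> right_vertices r.
        (0 < excess c a F v \<longrightarrow> v \<in> S) \<and> (v \<in> S \<longrightarrow> 0 \<le> excess c a F v))"

lemma finite_vertices [simp]:
  "finite (left_vertices l)" "finite (right_vertices r)"
  by (auto simp: left_vertices_def right_vertices_def)

lemma sum_left_vertices: "sum h (left_vertices l) = (\<Sum>i=1..l. h (U i))"
  unfolding left_vertices_def by (subst sum.reindex) (auto simp: inj_on_def)

lemma sum_right_vertices: "sum h (right_vertices r) = (\<Sum>j=1..r. h (V j))"
  unfolding right_vertices_def by (subst sum.reindex) (auto simp: inj_on_def)

lemma sum_vertices:
  "sum h (left_vertices l \<union> right_vertices r) = (\<Sum>i=1..l. h (U i)) + (\<Sum>j=1..r. h (V j))"
  by (subst sum.union_disjoint)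
    (auto simp: sum_left_vertices sum_right_vertices, auto simp: left_vertices_def right_vertices_def)

section \<open>Degrees and edge sums over a vertex set\<close>

context discrepancy_instance
begin

lemma finite_E: "finite E"
  using edges by (rule finite_subset) auto

lemma finite_neighbours:
  assumes "F \<subseteq> E"
  shows "finite {y. (x, y) \<in> F}" "finite {x. (x, y) \<in> F}"
proof -
  have "finite F" using assms finite_E by (rule finite_subset)
  thus "finite {y. (x, y) \<in> F}" by (rule finite_surj[where f = snd]) force
  show "finite {x. (x, y) \<in> F}" using \<open>finite F\<close> by (rule finite_surj[where f = fst]) force
qed

text \<open>Writing a degree as a sum of indicators over edges of E gives it the shape of a flow
  balance, so that \<open>sum_fst\<close> and \<open>sum_snd\<close> apply to subgraphs and flows
  alike.\<close>

lemma out_deg_sum: "F \<subseteq> E \<Longrightarrow> out_deg F x = (\<Sum>e\<in>{e \<in> E. fst e = x}. of_bool (e \<in> F))"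
proof -
  assume F: "F \<subseteq> E"
  have "(\<Sum>e\<in>{e \<in> E. fst e = x}. of_bool (e \<in> F)) = card {e \<in> F. fst e = x}"
    using F finite_E by (subst sum_of_bool_eq) (auto intro!: arg_cong[where f = card])
  also have "{e \<in> F. fst e = x} = Pair x ` {y. (x, y) \<in> F}"
    by force
  also have "card \<dots> = out_deg F x"
    unfolding out_deg_def by (rule card_image) (auto simp: inj_on_def)
  finally show ?thesis by simp
qed

lemma in_deg_sum: "F \<subseteq> E \<Longrightarrow> in_deg F y = (\<Sum>e\<in>{e \<in> E. snd e = y}. of_bool (e \<in> F))"
proof -
  assume F: "F \<subseteq> E"
  have "(\<Sum>e\<in>{e \<in> E. snd e = y}. of_bool (e \<in> F)) = card {e \<in> F. snd e = y}"
    using F finite_E by (subst sum_of_bool_eq) (auto intro!: arg_cong[where f = card])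
  also have "{e \<in> F. snd e = y} = (\<lambda>x. (x, y)) ` {x. (x, y) \<in> F}"
    by force
  also have "card \<dots> = in_deg F y"
    unfolding in_deg_def by (rule card_image) (auto simp: inj_on_def)
  finally show ?thesis by simp
qed

text \<open>Groups the edges by their left endpoint. With S = \<open>UNIV\<close> this counts all
  edges; with a cut S it gives the amount sent out by the left part of S.\<close>

lemma sum_fst: "(\<Sum>i\<in>{i\<in>{1..l}. U i \<in> S}. \<Sum>e\<in>{e \<in> E. fst e = U i}. g e)
    = (\<Sum>e\<in>E. of_bool (fst e \<in> S) * (g e :: real))"
proof -
  have "(\<Sum>i\<in>{i\<in>{1..l}. U i \<in> S}. \<Sum>e\<in>{e \<in> E. fst e = U i}. g e)
    = (\<Sum>e\<in>(\<Union>i\<in>{i\<in>{1..l}. U i \<in> S}. {e \<in> E. fst e = U i}). g e)"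
    using finite_E by (subst sum.UNION_disjoint) auto
  also have "(\<Union>i\<in>{i\<in>{1..l}. U i \<in> S}. {e \<in> E. fst e = U i}) = {e \<in> E. fst e \<in> S}"
    using edges by (force simp: left_vertices_def)
  also have "sum g \<dots> = (\<Sum>e\<in>E. of_bool (fst e \<in> S) * g e)"
    using finite_E by (intro sum.mono_neutral_cong_left) auto
  finally show ?thesis .
qed

lemma sum_snd: "(\<Sum>j\<in>{j\<in>{1..r}. V j \<in> S}. \<Sum>e\<in>{e \<in> E. snd e = V j}. g e)
    = (\<Sum>e\<in>E. of_bool (snd e \<in> S) * (g e :: real))"
proof -
  have "(\<Sum>j\<in>{j\<in>{1..r}. V j \<in> S}. \<Sum>e\<in>{e \<in> E. snd e = V j}. g e)
    = (\<Sum>e\<in>(\<Union>j\<in>{j\<in>{1..r}. V j \<in> S}. {e \<in> E. snd e = V j}). g e)"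
    using finite_E by (subst sum.UNION_disjoint) auto
  also have "(\<Union>j\<in>{j\<in>{1..r}. V j \<in> S}. {e \<in> E. snd e = V j}) = {e \<in> E. snd e \<in> S}"
    using edges by (force simp: right_vertices_def)
  also have "sum g \<dots> = (\<Sum>e\<in>E. of_bool (snd e \<in> S) * g e)"
    using finite_E by (intro sum.mono_neutral_cong_left) auto
  finally show ?thesis .
qed

section \<open>The flow network as an explicit system of linear constraints\<close>

abbreviation "N \<equiv> discrepancy_network l r E c a"

definition copy_arc :: "vertex \<times> vertex \<Rightarrow> node \<times> node" where
  "copy_arc e = (Copy (fst e), Copy (snd e))"

lemma copy_arc_simps [simp]:
  "fst (copy_arc e) = Copy (fst e)" "snd (copy_arc e) = Copy (snd e)"
  by (simp_all add: copy_arc_def)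

lemma copy_arc_eq_iff [simp]: "(p, q) = copy_arc e \<longleftrightarrow> p = Copy (fst e) \<and> q = Copy (snd e)"
  by (simp add: copy_arc_def)

lemma inj_copy_arc: "inj_on copy_arc A"
  by (auto simp: inj_on_def copy_arc_def prod_eq_iff)

lemma arcs_N: "arcs N = copy_arc ` E \<union> (\<lambda>j. (Copy (V j), T1)) ` {1..r}
    \<union> (\<lambda>j. (Copy (V j), T2)) ` {1..r} \<union> {(T1, T2)}"
proof -
  have A: "{(Copy x, Copy y) | x y. (x, y) \<in> E} = copy_arc ` E"
    by (force simp: copy_arc_def)
  have B: "{(Copy y, t) | y. y \<in> right_vertices r} = (\<lambda>j. (Copy (V j), t)) ` {1..r}" for t
    by (auto simp: right_vertices_def)
  show ?thesis
    unfolding discrepancy_network_def flow_network.simps A B ..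
qed

lemma nodes_N: "nodes N = (\<lambda>i. Copy (U i)) ` {1..l} \<union> (\<lambda>j. Copy (V j)) ` {1..r} \<union> {T1, T2}"
  by (auto simp: discrepancy_network_def right_vertices_def left_vertices_def)

lemma ball_copy_arc: "(\<forall>e\<in>copy_arc ` E. P e) \<longleftrightarrow> (\<forall>e\<in>E. P (copy_arc e))"
  by auto

lemma E_elim:
  assumes "e \<in> E"
  obtains i j where "e = (U i, V j)" "i \<in> {1..l}" "j \<in> {1..r}"
  using assms edges by (force simp: left_vertices_def right_vertices_def)

lemma E_sides: "(V j, y) \<notin> E" "(x, U i) \<notin> E"
  by (auto elim!: E_elim)

lemma capacity_N:
  "e \<in> E \<Longrightarrow> capacity N (copy_arc e) = 1"
  "capacity N (Copy (V j), T1) = ereal (real (a j))"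
  "capacity N (Copy (V j), T2) = \<infinity>"
  "capacity N (T1, T2) = \<infinity>"
  by (auto simp: discrepancy_network_def copy_arc_def split: vertex.splits elim!: E_elim)

lemma cost_N:
  "cost N (Copy x, Copy y) = 0"
  "cost N (copy_arc e) = 0"
  "cost N (Copy (V j), T1) = 0"
  "cost N (Copy (V j), T2) = 2"
  "cost N (T1, T2) = 0"
  by (auto simp: discrepancy_network_def copy_arc_def split: vertex.splits)

lemma balance_N:
  "balance N (Copy (U i)) = c i"
  "balance N (Copy (V j)) = 0"
  "balance N T1 = 0"
  "balance N T2 = - real (\<Sum>j=1..r. a j)"
  by (auto simp: discrepancy_network_def)

lemma out_arcs:
  "{e \<in> arcs N. fst e = Copy (U i)} = copy_arc ` {e \<in> E. fst e = U i}"
  "j \<in> {1..r} \<Longrightarrow> {e \<in> arcs N. fst e = Copy (V j)} = {(Copy (V j), T1), (Copy (V j), T2)}"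
  "{e \<in> arcs N. fst e = T1} = {(T1, T2)}"
  "{e \<in> arcs N. fst e = T2} = {}"
  unfolding arcs_N by (auto simp: E_sides)

lemma in_arcs:
  "{e \<in> arcs N. snd e = Copy (U i)} = {}"
  "j \<in> {1..r} \<Longrightarrow> {e \<in> arcs N. snd e = Copy (V j)} = copy_arc ` {e \<in> E. snd e = V j}"
  "{e \<in> arcs N. snd e = T1} = (\<lambda>j. (Copy (V j), T1)) ` {1..r}"
  "{e \<in> arcs N. snd e = T2} = insert (T1, T2) ((\<lambda>j. (Copy (V j), T2)) ` {1..r})"
  unfolding arcs_N by (auto simp: E_sides)

text \<open>Together with \<open>flow_cost_N\<close> this is the only interface to the network in
  the optimality argument; arcs, capacities and balances are not unfolded again.\<close>

lemma feasible_flow_iff: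
  "feasible_flow N f \<longleftrightarrow>
     (\<forall>e\<in>E. 0 \<le> f (copy_arc e) \<and> f (copy_arc e) \<le> 1) \<and>
     (\<forall>j\<in>{1..r}. 0 \<le> f (Copy (V j), T1) \<and> f (Copy (V j), T1) \<le> a j \<and> 0 \<le> f (Copy (V j), T2)) \<and>
     0 \<le> f (T1, T2) \<and>
     (\<forall>i\<in>{1..l}. (\<Sum>e\<in>{e \<in> E. fst e = U i}. f (copy_arc e)) = c i) \<and>
     (\<forall>j\<in>{1..r}. f (Copy (V j), T1) + f (Copy (V j), T2)
        = (\<Sum>e\<in>{e \<in> E. snd e = V j}. f (copy_arc e))) \<and>
     f (T1, T2) = (\<Sum>j=1..r. f (Copy (V j), T1)) \<and>
     f (T1, T2) + (\<Sum>j=1..r. f (Copy (V j), T2)) = (\<Sum>j=1..r. a j)"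
proof -
  have T2: "sum f (insert (T1, T2) ((\<lambda>j. (Copy (V j), T2)) ` {1..r})) =
      f (T1, T2) + (\<Sum>j=1..r. f (Copy (V j), T2))"
    by (subst sum.insert) (auto simp: sum.reindex inj_on_def)
  have T1: "sum f ((\<lambda>j. (Copy (V j), T1)) ` {1..r}) = (\<Sum>j=1..r. f (Copy (V j), T1))"
    by (auto simp: sum.reindex inj_on_def)
  have C: "sum f (copy_arc ` A) = (\<Sum>e\<in>A. f (copy_arc e))" for A
    by (simp add: sum.reindex inj_copy_arc)
  have bnd: "(\<forall>e\<in>arcs N. 0 \<le> f e \<and> ereal (f e) \<le> capacity N e) \<longleftrightarrow>
     (\<forall>e\<in>E. 0 \<le> f (copy_arc e) \<and> f (copy_arc e) \<le> 1) \<and>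
     (\<forall>j\<in>{1..r}. 0 \<le> f (Copy (V j), T1) \<and> f (Copy (V j), T1) \<le> a j \<and> 0 \<le> f (Copy (V j), T2)) \<and>
     0 \<le> f (T1, T2)"
    unfolding arcs_N ball_Un ball_copy_arc ball_simps by (auto simp: capacity_N)
  have bal: "(\<forall>x\<in>nodes N.
        (\<Sum>e\<in>{e \<in> arcs N. fst e = x}. f e) - (\<Sum>e\<in>{e \<in> arcs N. snd e = x}. f e) = balance N x) \<longleftrightarrow>
     (\<forall>i\<in>{1..l}. (\<Sum>e\<in>{e \<in> E. fst e = U i}. f (copy_arc e)) = c i) \<and>
     (\<forall>j\<in>{1..r}. f (Copy (V j), T1) + f (Copy (V j), T2)
        = (\<Sum>e\<in>{e \<in> E. snd e = V j}. f (copy_arc e))) \<and>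
     f (T1, T2) = (\<Sum>j=1..r. f (Copy (V j), T1)) \<and>
     f (T1, T2) + (\<Sum>j=1..r. f (Copy (V j), T2)) = (\<Sum>j=1..r. a j)"
    unfolding nodes_N ball_Un ball_simps
    by (auto simp: out_arcs in_arcs balance_N T1 T2 C simp flip: of_nat_sum simp del: One_nat_def)
  show ?thesis
    unfolding feasible_flow_def bnd bal by blast
qed

lemma flow_cost_N: "flow_cost N f = 2 * (\<Sum>j=1..r. f (Copy (V j), T2))"
proof -
  have "flow_cost N f = (\<Sum>e\<in>(\<lambda>j. (Copy (V j), T2)) ` {1..r}. cost N e * f e)"
    unfolding flow_cost_def
    by (rule sum.mono_neutral_right) (auto simp: arcs_N cost_N finite_E)
  also have "\<dots> = 2 * (\<Sum>j=1..r. f (Copy (V j), T2))"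
    by (subst sum.reindex) (auto simp: inj_on_def cost_N sum_distrib_left)
  finally show ?thesis .
qed

section \<open>Optimality from a cut: flows of solutions, weak duality and completion\<close>

lemma sum_in_deg:
  assumes "F \<subseteq> E"
  shows "(\<Sum>j=1..r. in_deg F (V j)) = (\<Sum>i=1..l. out_deg F (U i))"
proof -
  have "real (\<Sum>j=1..r. in_deg F (V j)) = real (\<Sum>i=1..l. out_deg F (U i))"
    using sum_fst[of "\<lambda>e. of_bool (e \<in> F)" UNIV] sum_snd[of "\<lambda>e. of_bool (e \<in> F)" UNIV]
    by (simp add: out_deg_sum[OF assms] in_deg_sum[OF assms] del: atLeastAtMost_iff)
  thus ?thesis by linarith
qed

text \<open>The deficits balance the surpluses, so the discrepancy is twice the surplus.\<close>

lemma discrepancy_eq_surplus: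
  assumes "feasible_solution l E c H"
  shows "discrepancy r a H = 2 * (\<Sum>j=1..r. max 0 (int (in_deg H (V j)) - int (a j)))"
proof -
  have "(\<Sum>j=1..r. in_deg H (V j)) = (\<Sum>j=1..r. a j)"
    using assms sum_in_deg[of H] sum_eq by (simp add: feasible_solution_def)
  hence "(\<Sum>j=1..r. int (in_deg H (V j)) - int (a j)) = 0"
    by (simp add: sum_subtractf flip: of_nat_sum)
  moreover have "\<bar>x\<bar> = 2 * max 0 x - x" for x :: int
    by auto
  ultimately show ?thesis
    unfolding discrepancy_def by (simp add: sum_subtractf sum_distrib_left)
qed

lemma flow_of_solution:
  assumes H: "feasible_solution l E c H"
  shows "\<exists>f. feasible_flow N f \<and> flow_cost N f = of_int (discrepancy r a H)"
proof -
  \<comment> \<open>Each right vertex fills its free arc to T1 first and sends only the surplus over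
    the arc of cost 2. The final default case is the value on the arc from T1 to T2.\<close>
  define f where "f = (\<lambda>e. case e of
      (Copy x, Copy y) \<Rightarrow> of_bool ((x, y) \<in> H)
    | (Copy y, T1) \<Rightarrow> (case y of V j \<Rightarrow> min (real (in_deg H y)) (a j) | _ \<Rightarrow> 0)
    | (Copy y, T2) \<Rightarrow> (case y of V j \<Rightarrow> max 0 (real (in_deg H y) - a j) | _ \<Rightarrow> 0)
    | _ \<Rightarrow> (\<Sum>j=1..r. min (real (in_deg H (V j))) (a j)))"
  have HE: "H \<subseteq> E" using H by (simp add: feasible_solution_def)
  have f1: "f (copy_arc e) = of_bool (e \<in> H)" for e
    by (simp add: f_def copy_arc_def)
  have f2: "f (Copy (V j), T1) = min (real (in_deg H (V j))) (a j)"
    "f (Copy (V j), T2) = max 0 (real (in_deg H (V j)) - a j)"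
    "f (T1, T2) = (\<Sum>j=1..r. min (real (in_deg H (V j))) (a j))" for j
    by (simp_all add: f_def)
  have "(\<Sum>j=1..r. min (real (in_deg H (V j))) (a j)) + (\<Sum>j=1..r. max 0 (real (in_deg H (V j)) - a j))
     = (\<Sum>j=1..r. real (in_deg H (V j)))"
    unfolding sum.distrib[symmetric] by (rule sum.cong) auto
  also have "\<dots> = (\<Sum>j=1..r. a j)"
    using H sum_in_deg[of H] sum_eq by (simp add: feasible_solution_def flip: of_nat_sum)
  finally have sm: "(\<Sum>j=1..r. min (real (in_deg H (V j))) (a j)) +
    (\<Sum>j=1..r. max 0 (real (in_deg H (V j)) - a j)) = (\<Sum>j=1..r. a j)" .
  have "feasible_flow N f"
    unfolding feasible_flow_iff f1 f2
  proof (intro conjI ballI)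
    fix i assume "i \<in> {1..l}"
    thus "(\<Sum>e\<in>{e \<in> E. fst e = U i}. of_bool (e \<in> H)) = real (c i)"
      using H out_deg_sum[OF HE, of "U i"] finite_E by (auto simp: feasible_solution_def)
  next
    fix j
    show "min (real (in_deg H (V j))) (a j) + max 0 (real (in_deg H (V j)) - a j) =
        (\<Sum>e\<in>{e \<in> E. snd e = V j}. of_bool (e \<in> H))"
      using in_deg_sum[OF HE, of "V j"] by auto
  qed (use sm in \<open>auto intro!: sum_nonneg\<close>)
  moreover have "flow_cost N f = of_int (discrepancy r a H)"
    unfolding flow_cost_N discrepancy_eq_surplus[OF H] f2 by (simp add: of_int_max)
  ultimately show ?thesis by blast
qed

text \<open>The sign conditions make the positive excess the sum of all excesses over S. In that sum
  an edge of F inside S cancels, no edge of F enters S, and every edge of E leaving S belongs to F.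
  Hence F disappears from the formula, which can then be compared with an arbitrary flow.\<close>

lemma total_excess_cut:
  assumes "cut_certificate l r E c a F S"
  shows "total_excess l r c a F = (\<Sum>i\<in>{i\<in>{1..l}. U i \<in> S}. real (c i))
    - (\<Sum>j\<in>{j\<in>{1..r}. V j \<in> S}. real (a j)) - (\<Sum>e\<in>E. of_bool (fst e \<in> S \<and> snd e \<notin> S))"
proof -
  have FE: "F \<subseteq> E" using assms by (auto simp: cut_certificate_def)
  have U: "max 0 (excess c a F v) = of_bool (v \<in> S) * excess c a F v"
    if "v \<in> left_vertices l \<union> right_vertices r" for v
  proof -
    have "(0 < excess c a F v \<longrightarrow> v \<in> S) \<and> (v \<in> S \<longrightarrow> 0 \<le> excess c a F v)"
      using assms that unfolding cut_certificate_def by metis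
    thus ?thesis by auto
  qed
  have "total_excess l r c a F = (\<Sum>v\<in>left_vertices l \<union> right_vertices r. of_bool (v \<in> S) * excess c a F v)"
    unfolding total_excess_def by (rule sum.cong[OF refl U])
  also have "real_of_int \<dots> = (\<Sum>i=1..l. of_bool (U i \<in> S) * (real (c i) - out_deg F (U i)))
      + (\<Sum>j=1..r. of_bool (V j \<in> S) * (real (in_deg F (V j)) - a j))"
    unfolding sum_vertices by (simp add: excess_def)
  also have "(\<Sum>i=1..l. of_bool (U i \<in> S) * (real (c i) - out_deg F (U i)))
      = (\<Sum>i\<in>{i\<in>{1..l}. U i \<in> S}. real (c i) - out_deg F (U i))"
    by (rule sum.mono_neutral_cong_right) auto
  also have "(\<Sum>j=1..r. of_bool (V j \<in> S) * (real (in_deg F (V j)) - a j))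
      = (\<Sum>j\<in>{j\<in>{1..r}. V j \<in> S}. real (in_deg F (V j)) - a j)"
    by (rule sum.mono_neutral_cong_right) auto
  also have "(\<Sum>i\<in>{i\<in>{1..l}. U i \<in> S}. real (c i) - out_deg F (U i)) =
      (\<Sum>i\<in>{i\<in>{1..l}. U i \<in> S}. real (c i)) - (\<Sum>e\<in>E. of_bool (fst e \<in> S) * of_bool (e \<in> F))"
    using sum_fst[of "\<lambda>e. of_bool (e \<in> F)" S] by (simp add: sum_subtractf out_deg_sum[OF FE])
  also have "(\<Sum>j\<in>{j\<in>{1..r}. V j \<in> S}. real (in_deg F (V j)) - a j) =
      (\<Sum>e\<in>E. of_bool (snd e \<in> S) * of_bool (e \<in> F)) - (\<Sum>j\<in>{j\<in>{1..r}. V j \<in> S}. real (a j))"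
    using sum_snd[of "\<lambda>e. of_bool (e \<in> F)" S] by (simp add: sum_subtractf in_deg_sum[OF FE])
  also have "(\<Sum>e\<in>E. of_bool (fst e \<in> S) * of_bool (e \<in> F)) =
      (\<Sum>e\<in>E. of_bool (snd e \<in> S) * of_bool (e \<in> F) + of_bool (fst e \<in> S \<and> snd e \<notin> S) :: real)"
  proof (rule sum.cong[OF refl])
    fix e assume e: "e \<in> E"
    obtain x y where xy: "e = (x, y)" by force
    have "x \<in> S \<Longrightarrow> y \<notin> S \<Longrightarrow> (x, y) \<in> F" "y \<in> S \<Longrightarrow> (x, y) \<in> F \<Longrightarrow> x \<in> S"
      using assms e unfolding cut_certificate_def xy by blast+
    thus "of_bool (fst e \<in> S) * of_bool (e \<in> F) =
        of_bool (snd e \<in> S) * of_bool (e \<in> F) + (of_bool (fst e \<in> S \<and> snd e \<notin> S) :: real)"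
      unfolding xy by (cases "x \<in> S"; cases "y \<in> S"; cases "(x, y) \<in> F") simp_all
  qed
  finally show ?thesis
    by (simp add: sum.distrib)
qed

text \<open>Weak duality: the supply inside S has to leave it. The edges leaving S carry at most 1
  each and the arcs to T1 at most \<open>a j\<close>; the remainder uses arcs of cost 2.\<close>

lemma flow_cost_ge:
  assumes cert: "cut_certificate l r E c a F S" and f: "feasible_flow N f"
  shows "2 * total_excess l r c a F \<le> flow_cost N f"
proof -
  note f = f[unfolded feasible_flow_iff]
  let ?I = "{i\<in>{1..l}. U i \<in> S}" and ?J = "{j\<in>{1..r}. V j \<in> S}"
  have "(\<Sum>i\<in>?I. real (c i)) - (\<Sum>j\<in>?J. f (Copy (V j), T1) + f (Copy (V j), T2))
      = (\<Sum>e\<in>E. of_bool (fst e \<in> S) * f (copy_arc e)) - (\<Sum>e\<in>E. of_bool (snd e \<in> S) * f (copy_arc e))"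
    using f sum_fst[of "\<lambda>e. f (copy_arc e)" S] sum_snd[of "\<lambda>e. f (copy_arc e)" S] by simp
  also have "\<dots> \<le> (\<Sum>e\<in>E. of_bool (fst e \<in> S \<and> snd e \<notin> S))"
    unfolding sum_subtractf[symmetric] using f by (intro sum_mono) auto
  finally have 1: "(\<Sum>i\<in>?I. real (c i)) - (\<Sum>j\<in>?J. f (Copy (V j), T1)) - (\<Sum>j\<in>?J. f (Copy (V j), T2))
      \<le> (\<Sum>e\<in>E. of_bool (fst e \<in> S \<and> snd e \<notin> S))"
    by (simp add: sum.distrib)
  have 2: "(\<Sum>j\<in>?J. f (Copy (V j), T1)) \<le> (\<Sum>j\<in>?J. real (a j))"
    using f by (intro sum_mono) auto
  have 3: "(\<Sum>j\<in>?J. f (Copy (V j), T2)) \<le> (\<Sum>j=1..r. f (Copy (V j), T2))"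
    using f by (intro sum_mono2) auto
  show ?thesis
    using 1 2 3 total_excess_cut[OF cert] unfolding flow_cost_N by simp
qed

text \<open>The prescribed out-degrees at different left vertices involve disjoint sets of edges, so
  each vertex can be completed on its own; \<open>out_deg_ge\<close> guarantees enough
  edges.\<close>

lemma extend_to_solution:
  assumes FE: "F \<subseteq> E" and F: "\<forall>i\<in>{1..l}. out_deg F (U i) \<le> c i"
  shows "\<exists>H. feasible_solution l E c H \<and> F \<subseteq> H"
proof -
  have "\<exists>B. {y. (U i, y) \<in> F} \<subseteq> B \<and> B \<subseteq> {y. (U i, y) \<in> E} \<and> card B = c i" if "i \<in> {1..l}" for i
  proof -
    have "card {y. (U i, y) \<in> F} \<le> c i" "c i \<le> card {y. (U i, y) \<in> E}"
      "{y. (U i, y) \<in> F} \<subseteq> {y. (U i, y) \<in> E}"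
      using that F out_deg_ge FE by (auto simp: out_deg_def)
    thus ?thesis using exists_subset_between finite_neighbours[OF subset_refl] by metis
  qed
  then obtain B where B: "\<And>i. i \<in> {1..l} \<Longrightarrow>
      {y. (U i, y) \<in> F} \<subseteq> B i \<and> B i \<subseteq> {y. (U i, y) \<in> E} \<and> card (B i) = c i"
    by metis
  define H where "H = {(U i, y) | i y. i \<in> {1..l} \<and> y \<in> B i}"
  have "F \<subseteq> H"
  proof
    fix e assume e: "e \<in> F"
    then obtain i j where "e = (U i, V j)" "i \<in> {1..l}"
      using FE E_elim by blast
    thus "e \<in> H" using e B by (auto simp: H_def)
  qed
  moreover have "{y. (U i, y) \<in> H} = B i" if "i \<in> {1..l}" for i
    using that by (auto simp: H_def)
  hence "feasible_solution l E c H"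
    using B by (auto simp: feasible_solution_def out_deg_def H_def)
  ultimately show ?thesis by blast
qed

lemma in_deg_mono:
  assumes "F \<subseteq> H" "H \<subseteq> E"
  shows "in_deg F y \<le> in_deg H y"
  unfolding in_deg_def using finite_neighbours(2)[OF assms(2)] assms(1)
  by (intro card_mono) auto

text \<open>Every added edge raises the surplus of its head by at most one and lowers the excess of
  its tail by exactly one, so the total positive excess does not grow. At the end all of it is
  surplus on the right.\<close>

lemma discrepancy_extension_le:
  assumes "F \<subseteq> H" and H: "feasible_solution l E c H"
    and F: "\<forall>i\<in>{1..l}. out_deg F (U i) \<le> c i"
  shows "discrepancy r a H \<le> 2 * total_excess l r c a F"
proof -
  have HE: "H \<subseteq> E" using H by (simp add: feasible_solution_def)
  have FE: "F \<subseteq> E" using HE assms by blast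
  have "(\<Sum>j=1..r. max 0 (int (in_deg H (V j)) - int (a j)))
      \<le> (\<Sum>j=1..r. max 0 (int (in_deg F (V j)) - int (a j)) + (int (in_deg H (V j)) - int (in_deg F (V j))))"
  proof (rule sum_mono)
    fix j
    show "max 0 (int (in_deg H (V j)) - int (a j)) \<le>
      max 0 (int (in_deg F (V j)) - int (a j)) + (int (in_deg H (V j)) - int (in_deg F (V j)))"
      using in_deg_mono[OF \<open>F \<subseteq> H\<close> HE, of "V j"] by auto
  qed
  also have "\<dots> = (\<Sum>j=1..r. max 0 (excess c a F (V j)))
      + (int (\<Sum>j=1..r. in_deg H (V j)) - int (\<Sum>j=1..r. in_deg F (V j)))"
    by (simp add: sum.distrib sum_subtractf excess_def)
  also have "int (\<Sum>j=1..r. in_deg H (V j)) - int (\<Sum>j=1..r. in_deg F (V j)) =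
      (\<Sum>i=1..l. int (out_deg H (U i)) - int (out_deg F (U i)))"
    unfolding sum_in_deg[OF HE] sum_in_deg[OF FE] by (simp add: sum_subtractf)
  also have "\<dots> = (\<Sum>i=1..l. max 0 (excess c a F (U i)))"
    using F H by (intro sum.cong) (auto simp: excess_def feasible_solution_def)
  finally show ?thesis
    unfolding discrepancy_eq_surplus[OF H] total_excess_def sum_vertices by simp
qed

text \<open>A sandwich: the cut bound for flows also bounds solutions, as each solution induces a
  flow of the same value, and a completion of F meets the bound from above.\<close>

theorem cut_certificate_optimal:
  assumes cert: "cut_certificate l r E c a F S"
  shows "min_discrepancy l r E c a = 2 * total_excess l r c a F"
    and "is_min_flow_cost N (of_int (2 * total_excess l r c a F))"
proof -
  have ge: "2 * total_excess l r c a F \<le> discrepancy r a H" if "feasible_solution l E c H" for H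
    using flow_of_solution[OF that] flow_cost_ge[OF cert] by (metis of_int_le_iff of_int_mult of_int_numeral)
  obtain H where H: "feasible_solution l E c H" "F \<subseteq> H"
    using extend_to_solution cert unfolding cut_certificate_def by metis
  have eq: "discrepancy r a H = 2 * total_excess l r c a F"
    using ge[OF H(1)] discrepancy_extension_le[OF H(2,1)] cert unfolding cut_certificate_def by auto
  have "finite {H. feasible_solution l E c H}"
    by (rule finite_subset[of _ "Pow E"]) (auto simp: feasible_solution_def finite_E)
  thus "min_discrepancy l r E c a = 2 * total_excess l r c a F"
    unfolding min_discrepancy_def
  proof (intro Min_eqI)
    show "2 * total_excess l r c a F \<in> discrepancy r a ` {H. feasible_solution l E c H}"
      using H(1) eq by (metis imageI mem_Collect_eq)
  qed (use ge in auto)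
  show "is_min_flow_cost N (of_int (2 * total_excess l r c a F))"
    unfolding is_min_flow_cost_def
    using flow_of_solution[OF H(1)] flow_cost_ge[OF cert] eq by simp
qed

end


section \<open>Valid labellings\<close>

context discrepancy_instance
begin

abbreviation "verts \<equiv> left_vertices l \<union> right_vertices r"

definition residual :: "(vertex \<times> vertex) set \<Rightarrow> vertex \<Rightarrow> vertex \<Rightarrow> bool" where
  "residual F x y \<longleftrightarrow> (x, y) \<in> E - F \<or> (y, x) \<in> F"

text \<open>The last clause forces vertices with a deficit to stay at label 0, where they act as the
  sinks. Nonnegative excess on the left says that F respects the \<open>c i\<close>.\<close>

definition valid_labelling :: "(vertex \<times> vertex) set \<Rightarrow> (vertex \<Rightarrow> nat) \<Rightarrow> bool" where
  "valid_labelling F d \<longleftrightarrow> F \<subseteq> E \<and>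
     (\<forall>i\<in>{1..l}. 0 \<le> excess c a F (U i)) \<and>
     (\<forall>x y. residual F x y \<longrightarrow> d x \<le> Suc (d y)) \<and>
     (\<forall>v\<in>verts. d v \<le> l + r \<and> (0 < d v \<longrightarrow> 0 \<le> excess c a F v))"

text \<open>A push along a residual arc descends by one label and hands the contribution of its edge from the
  label of the lower end to that of the upper one. So every push raises the potential by one.\<close>

definition potential :: "(vertex \<times> vertex) set \<Rightarrow> (vertex \<Rightarrow> nat) \<Rightarrow> nat" where
  "potential F d = (\<Sum>e\<in>E. if e \<in> F then d (fst e) else d (snd e)) + (\<Sum>v\<in>fst ` E \<union> snd ` E. d v)"

lemma verts_of_edge: "(x, y) \<in> E \<Longrightarrow> x \<in> verts \<and> y \<in> verts"
  using edges by auto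

lemma card_verts: "card verts = l + r"
  by (subst card_Un_disjoint)
    (auto simp: left_vertices_def right_vertices_def card_image inj_on_def)

section \<open>Pushes, relabellings and the bound on their number\<close>

lemma excess_insert:
  assumes "F \<subseteq> E" "(x, y) \<in> E" "(x, y) \<notin> F"
  shows "excess c a (insert (x, y) F) v = excess c a F v + of_bool (v = y) - of_bool (v = x)"
proof -
  obtain i j where xy: "x = U i" "y = V j"
    using assms(2) E_elim by blast
  have "{w. (x, w) \<in> insert (x, y) F} = insert y {w. (x, w) \<in> F}"
    "{w. (w, y) \<in> insert (x, y) F} = insert x {w. (w, y) \<in> F}"
    by auto
  hence "out_deg (insert (x, y) F) x = Suc (out_deg F x)"
    "in_deg (insert (x, y) F) y = Suc (in_deg F y)"
    using assms(3) finite_neighbours[OF assms(1)] by (simp_all add: out_deg_def in_deg_def)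
  moreover have "v \<noteq> x \<Longrightarrow> out_deg (insert (x, y) F) v = out_deg F v"
    "v \<noteq> y \<Longrightarrow> in_deg (insert (x, y) F) v = in_deg F v"
    by (auto simp: out_deg_def in_deg_def)
  ultimately show ?thesis
    unfolding excess_def xy by (cases v) auto
qed

lemma push:
  assumes inv: "valid_labelling F d" and res: "residual F x y"
    and act: "0 < excess c a F x" and adm: "d x = Suc (d y)"
  obtains F' where "valid_labelling F' d" "potential F' d = Suc (potential F d)"
    "\<And>v. excess c a F' v = excess c a F v + of_bool (v = y) - of_bool (v = x)"
    "\<And>u v. residual F' u v \<longleftrightarrow> residual F u v \<and> (u, v) \<noteq> (x, y) \<or> (u, v) = (y, x)"
proof -
  have FE: "F \<subseteq> E" using inv by (simp add: valid_labelling_def)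
  have asym: "(v, u) \<notin> E" if "(u, v) \<in> E" for u v
    using that by (auto elim!: E_elim)
  define F' where "F' = (if (x, y) \<in> E then insert (x, y) F else F - {(y, x)})"
  \<comment> \<open>The only edge whose membership in F changes, hence the only summand of the
    potential that does.\<close>
  define e where "e = (if (x, y) \<in> E then (x, y) else (y, x))"
  have F'E: "F' \<subseteq> E" using FE by (auto simp: F'_def)
  have e: "e \<in> E" using res FE by (auto simp: e_def residual_def)
  have xyF: "(x, y) \<in> E \<Longrightarrow> (x, y) \<notin> F" "(x, y) \<notin> E \<Longrightarrow> (y, x) \<in> F"
    using res asym FE by (auto simp: residual_def)
  have ex: "excess c a F' v = excess c a F v + of_bool (v = y) - of_bool (v = x)" for v
  proof (cases "(x, y) \<in> E")
    case True
    thus ?thesis using excess_insert[OF FE] xyF by (simp add: F'_def)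
  next
    case False
    hence "insert (y, x) F' = F" "(y, x) \<notin> F'" "(y, x) \<in> E"
      using xyF FE by (auto simp: F'_def)
    thus ?thesis using excess_insert[OF F'E, of y x v] by simp
  qed
  have rs: "residual F' u v \<longleftrightarrow> residual F u v \<and> (u, v) \<noteq> (x, y) \<or> (u, v) = (y, x)" for u v
    using xyF asym FE by (auto simp: F'_def residual_def)
  let ?g = "\<lambda>F e. if e \<in> F then d (fst e) else d (snd e)"
  have "sum (?g F') E = ?g F' e + sum (?g F') (E - {e})"
    by (rule sum.remove[OF finite_E e])
  also have "sum (?g F') (E - {e}) = sum (?g F) (E - {e})"
    by (intro sum.cong) (auto simp: F'_def e_def)
  also have "?g F' e = Suc (?g F e)"
    using xyF adm by (auto simp: F'_def e_def)
  also have "Suc (?g F e) + sum (?g F) (E - {e}) = Suc (sum (?g F) E)"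
    by (simp add: sum.remove[OF finite_E e])
  finally have pot: "potential F' d = Suc (potential F d)"
    by (simp add: potential_def)
  have "valid_labelling F' d"
    unfolding valid_labelling_def
  proof (intro conjI ballI allI impI)
    fix u v assume "residual F' u v"
    thus "d u \<le> Suc (d v)"
      using inv adm unfolding rs valid_labelling_def by auto
  next
    fix i assume "i \<in> {1..l}"
    hence "0 \<le> excess c a F (U i)" using inv by (simp add: valid_labelling_def)
    thus "0 \<le> excess c a F' (U i)" using act by (auto simp: ex)
  next
    fix v assume v: "v \<in> verts" "0 < d v"
    hence "0 \<le> excess c a F v" using inv by (simp add: valid_labelling_def)
    thus "0 \<le> excess c a F' v" using act by (auto simp: ex)
  qed (use F'E inv in \<open>auto simp: valid_labelling_def\<close>)
  thus ?thesis using pot ex rs that by blast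
qed

text \<open>A positive excess needs \<open>c i\<close> > 0 on the left, and so an edge by the degree
  hypothesis, and an edge of F on the right. Hence each relabelling raises a label that the
  potential counts, although isolated vertices are left out of it.\<close>

lemma edge_of_active:
  assumes "F \<subseteq> E" "x \<in> verts" "0 < excess c a F x"
  shows "x \<in> fst ` E \<union> snd ` E"
proof (cases x)
  case (U i)
  hence "i \<in> {1..l}" using assms(2) by (auto simp: left_vertices_def right_vertices_def)
  moreover have "0 < c i" using U assms(3) by (simp add: excess_def)
  ultimately have "card {y. (x, y) \<in> E} \<noteq> 0"
    using out_deg_ge U by (force simp: out_deg_def)
  hence "{y. (x, y) \<in> E} \<noteq> {}" by (metis card.empty)
  thus ?thesis by force
next
  case (V j)
  hence "card {y. (y, x) \<in> F} \<noteq> 0" using assms(3) by (auto simp: excess_def in_deg_def)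
  hence "{y. (y, x) \<in> F} \<noteq> {}" by (metis card.empty)
  thus ?thesis using assms(1) by force
qed

text \<open>When all residual successors of x lie at its level or above, raising x by one keeps the
  drop along every residual arc at most one. Arcs into x only gain slack.\<close>

lemma relabel:
  assumes inv: "valid_labelling F d" and x: "x \<in> verts" "0 < excess c a F x" "d x < l + r"
    and stuck: "\<And>y. residual F x y \<Longrightarrow> d x \<le> d y"
  shows "valid_labelling F (d(x := Suc (d x)))" "potential F d < potential F (d(x := Suc (d x)))"
proof -
  have FE: "F \<subseteq> E" using inv by (simp add: valid_labelling_def)
  have "finite (fst ` E \<union> snd ` E)" using finite_E by simp
  hence "(\<Sum>v\<in>fst ` E \<union> snd ` E. d v) < (\<Sum>v\<in>fst ` E \<union> snd ` E. (d(x := Suc (d x))) v)"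
    using edge_of_active[OF FE x(1,2)] by (intro sum_strict_mono_ex1) auto
  moreover have "(\<Sum>e\<in>E. if e \<in> F then d (fst e) else d (snd e)) \<le>
      (\<Sum>e\<in>E. if e \<in> F then (d(x := Suc (d x))) (fst e) else (d(x := Suc (d x))) (snd e))"
    by (intro sum_mono) auto
  ultimately show "potential F d < potential F (d(x := Suc (d x)))"
    unfolding potential_def by linarith
  have "\<not> residual F x x"
    using FE E_sides by (cases x) (auto simp: residual_def)
  thus "valid_labelling F (d(x := Suc (d x)))"
    using inv x stuck unfolding valid_labelling_def by (auto intro: le_SucI)
qed

text \<open>One label per edge and at most two endpoints per edge, each label being at most l +
  r.\<close>

lemma potential_le:
  assumes "valid_labelling F d"
  shows "potential F d \<le> 3 * (l + r) * card E"
proof -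
  have d: "d v \<le> l + r" if "v \<in> fst ` E \<union> snd ` E" for v
    using that assms verts_of_edge unfolding valid_labelling_def by fastforce
  have "(\<Sum>e\<in>E. if e \<in> F then d (fst e) else d (snd e)) \<le> card E * (l + r)"
    using d by (intro sum_bounded_above[where 'a = nat, simplified]) auto
  moreover have "(\<Sum>v\<in>fst ` E \<union> snd ` E. d v) \<le> card (fst ` E \<union> snd ` E) * (l + r)"
    using d by (intro sum_bounded_above[where 'a = nat, simplified]) auto
  moreover have "card (fst ` E \<union> snd ` E) \<le> 2 * card E"
    using card_Un_le[of "fst ` E" "snd ` E"] card_image_le[OF finite_E, of fst]
      card_image_le[OF finite_E, of snd] by linarith
  hence "card (fst ` E \<union> snd ` E) * (l + r) \<le> 2 * card E * (l + r)"
    by (rule mult_right_mono) simp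
  ultimately show ?thesis
    unfolding potential_def by (simp add: algebra_simps)
qed

lemma valid_labelling_empty: "valid_labelling {} (\<lambda>_. 0)"
  by (auto simp: valid_labelling_def excess_def out_deg_def)

text \<open>By the pigeonhole principle some level \<open>k \<le> l + r\<close> carries no vertex; as labels drop by at most
  one along residual arcs, no residual arc leaves the set of vertices above that level.\<close>

lemma valid_labelling_certificate:
  assumes inv: "valid_labelling F d"
    and final: "\<And>v. v \<in> verts \<Longrightarrow> 0 < excess c a F v \<Longrightarrow> l + r \<le> d v"
  obtains S where "cut_certificate l r E c a F S"
proof -
  have "card (d ` verts) \<le> l + r"
    using card_image_le[of verts d] card_verts by simp
  hence "\<not> {..l + r} \<subseteq> d ` verts"
    using card_mono[of "d ` verts" "{..l + r}"] by auto
  then obtain k where k: "k \<le> l + r" "\<And>v. v \<in> verts \<Longrightarrow> d v \<noteq> k"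
    by auto
  have FE: "F \<subseteq> E" using inv by (simp add: valid_labelling_def)
  have closed: "k < d y" if "residual F x y" "k < d x" for x y
  proof -
    have "x \<in> verts" "y \<in> verts"
      using that(1) FE verts_of_edge by (auto simp: residual_def)
    moreover have "d x \<le> Suc (d y)"
      using inv that by (simp add: valid_labelling_def)
    ultimately show ?thesis
      using k(2)[of y] that(2) by linarith
  qed
  have "cut_certificate l r E c a F {v. k < d v}"
    unfolding cut_certificate_def mem_Collect_eq
  proof (intro conjI ballI allI impI)
    fix i assume "i \<in> {1..l}"
    thus "out_deg F (U i) \<le> c i"
      using inv by (force simp: valid_labelling_def excess_def)
  next
    fix v assume v: "v \<in> verts" "0 < excess c a F v"
    thus "k < d v" using final[OF v] k by (metis le_neq_implies_less le_trans)
  next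
    fix v assume "v \<in> verts" "k < d v"
    thus "0 \<le> excess c a F v" using inv by (auto simp: valid_labelling_def)
  qed (use FE closed in \<open>auto simp: residual_def\<close>)
  thus ?thesis by (rule that)
qed

end


section \<open>Timed execution of programs\<close>

text \<open>A total-correctness triple with a time budget. T is only an upper bound, so that
  branches and loop iterations can share a common, rounded estimate.\<close>

definition runs ::
  "com \<Rightarrow> (nat \<Rightarrow> nat) \<Rightarrow> (nat \<Rightarrow> nat) \<Rightarrow> nat \<Rightarrow> ((nat \<Rightarrow> nat) \<Rightarrow> (nat \<Rightarrow> nat) \<Rightarrow> bool) \<Rightarrow> bool" where
  "runs p \<rho> \<mu> T Q \<longleftrightarrow> (\<exists>t \<rho>' \<mu>'. exec p (\<rho>, \<mu>) t (\<rho>', \<mu>') \<and> t \<le> T \<and> Q \<rho>' \<mu>')"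

abbreviation seq_com (infixr ";;" 60) where "p ;; q \<equiv> Seq p q"

lemma runs_mono:
  "runs p \<rho> \<mu> T Q \<Longrightarrow> T \<le> T' \<Longrightarrow> (\<And>\<rho>' \<mu>'. Q \<rho>' \<mu>' \<Longrightarrow> Q' \<rho>' \<mu>') \<Longrightarrow> runs p \<rho> \<mu> T' Q'"
  unfolding runs_def by (meson le_trans)

lemma runs_Skip [simp]: "runs Skip \<rho> \<mu> T Q \<longleftrightarrow> 1 \<le> T \<and> Q \<rho> \<mu>"
  unfolding runs_def using exec_Skip[of "(\<rho>, \<mu>)"] by (auto elim: exec.cases)

lemma runs_Assign [simp]:
  "runs (Assign x e) \<rho> \<mu> T Q \<longleftrightarrow> eval_time e + 1 \<le> T \<and> Q (\<rho>(x := eval e (\<rho>, \<mu>))) \<mu>"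
proof
  assume "runs (Assign x e) \<rho> \<mu> T Q"
  thus "eval_time e + 1 \<le> T \<and> Q (\<rho>(x := eval e (\<rho>, \<mu>))) \<mu>"
    unfolding runs_def by (auto elim: exec.cases)
next
  assume "eval_time e + 1 \<le> T \<and> Q (\<rho>(x := eval e (\<rho>, \<mu>))) \<mu>"
  thus "runs (Assign x e) \<rho> \<mu> T Q"
    using exec_Assign[of x e "(\<rho>, \<mu>)"] unfolding runs_def by auto
qed

lemma runs_Store [simp]:
  "runs (Store e1 e2) \<rho> \<mu> T Q \<longleftrightarrow> eval_time e1 + eval_time e2 + 1 \<le> T \<and>
     Q \<rho> (\<mu>(eval e1 (\<rho>, \<mu>) := eval e2 (\<rho>, \<mu>)))"
proof
  assume "runs (Store e1 e2) \<rho> \<mu> T Q"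
  thus "eval_time e1 + eval_time e2 + 1 \<le> T \<and> Q \<rho> (\<mu>(eval e1 (\<rho>, \<mu>) := eval e2 (\<rho>, \<mu>)))"
    unfolding runs_def by (auto elim: exec.cases)
next
  assume "eval_time e1 + eval_time e2 + 1 \<le> T \<and> Q \<rho> (\<mu>(eval e1 (\<rho>, \<mu>) := eval e2 (\<rho>, \<mu>)))"
  thus "runs (Store e1 e2) \<rho> \<mu> T Q"
    using exec_Store[of e1 e2 "(\<rho>, \<mu>)"] unfolding runs_def by auto
qed

lemma runs_Seq:
  assumes "runs p \<rho> \<mu> ta P" "\<And>\<rho>' \<mu>'. P \<rho>' \<mu>' \<Longrightarrow> runs q \<rho>' \<mu>' tb Q" "ta + tb \<le> T"
  shows "runs (p ;; q) \<rho> \<mu> T Q"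
proof -
  obtain t \<rho>' \<mu>' where p: "exec p (\<rho>, \<mu>) t (\<rho>', \<mu>')" "t \<le> ta" "P \<rho>' \<mu>'"
    using assms(1) unfolding runs_def by blast
  then obtain t' \<rho>'' \<mu>'' where q: "exec q (\<rho>', \<mu>') t' (\<rho>'', \<mu>'')" "t' \<le> tb" "Q \<rho>'' \<mu>''"
    using assms(2) unfolding runs_def by blast
  have "t + t' \<le> T" using p q assms(3) by linarith
  with exec_Seq[OF p(1) q(1)] q(3) show ?thesis
    unfolding runs_def by blast
qed

text \<open>Stated as a simplification rule so that straight-line code is executed symbolically. The
  conjunct on T keeps the truncated subtraction of the spent time exact.\<close>

lemma runs_Assign_Seq [simp]:
  "runs (Assign x e ;; q) \<rho> \<mu> T Q \<longleftrightarrow> eval_time e + 1 \<le> T \<and>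
     runs q (\<rho>(x := eval e (\<rho>, \<mu>))) \<mu> (T - (eval_time e + 1)) Q"
proof
  assume "runs (Assign x e ;; q) \<rho> \<mu> T Q"
  then obtain t \<rho>' \<mu>' where t: "exec (Assign x e ;; q) (\<rho>, \<mu>) t (\<rho>', \<mu>')" "t \<le> T" "Q \<rho>' \<mu>'"
    unfolding runs_def by blast
  from t(1) obtain t1 t2 s where 1: "exec (Assign x e) (\<rho>, \<mu>) t1 s" "exec q s t2 (\<rho>', \<mu>')" "t = t1 + t2"
    by (auto elim: exec.cases)
  from 1(1) have "s = (\<rho>(x := eval e (\<rho>, \<mu>)), \<mu>)" "t1 = eval_time e + 1"
    by (auto elim: exec.cases)
  moreover have "t2 \<le> T - t1" "t1 \<le> T" using 1 t by auto
  ultimately show "eval_time e + 1 \<le> T \<and>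
     runs q (\<rho>(x := eval e (\<rho>, \<mu>))) \<mu> (T - (eval_time e + 1)) Q"
    using 1 t unfolding runs_def by blast
next
  assume *: "eval_time e + 1 \<le> T \<and> runs q (\<rho>(x := eval e (\<rho>, \<mu>))) \<mu> (T - (eval_time e + 1)) Q"
  show "runs (Assign x e ;; q) \<rho> \<mu> T Q"
    by (rule runs_Seq[where ta = "eval_time e + 1" and tb = "T - (eval_time e + 1)" and
          P = "\<lambda>\<rho>' \<mu>'. \<rho>' = \<rho>(x := eval e (\<rho>, \<mu>)) \<and> \<mu>' = \<mu>"]) (use * in auto)
qed

lemma runs_Store_Seq [simp]:
  "runs (Store e1 e2 ;; q) \<rho> \<mu> T Q \<longleftrightarrow> eval_time e1 + eval_time e2 + 1 \<le> T \<and>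
     runs q \<rho> (\<mu>(eval e1 (\<rho>, \<mu>) := eval e2 (\<rho>, \<mu>))) (T - (eval_time e1 + eval_time e2 + 1)) Q"
    (is "_ \<longleftrightarrow> ?t \<le> T \<and> _")
proof
  assume "runs (Store e1 e2 ;; q) \<rho> \<mu> T Q"
  then obtain t \<rho>' \<mu>' where t: "exec (Store e1 e2 ;; q) (\<rho>, \<mu>) t (\<rho>', \<mu>')" "t \<le> T" "Q \<rho>' \<mu>'"
    unfolding runs_def by blast
  from t(1) obtain t1 t2 s where 1: "exec (Store e1 e2) (\<rho>, \<mu>) t1 s" "exec q s t2 (\<rho>', \<mu>')" "t = t1 + t2"
    by (auto elim: exec.cases)
  from 1(1) have "s = (\<rho>, \<mu>(eval e1 (\<rho>, \<mu>) := eval e2 (\<rho>, \<mu>)))" "t1 = ?t"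
    by (auto elim: exec.cases)
  moreover have "t2 \<le> T - t1" "t1 \<le> T" using 1 t by auto
  ultimately show "?t \<le> T \<and> runs q \<rho> (\<mu>(eval e1 (\<rho>, \<mu>) := eval e2 (\<rho>, \<mu>))) (T - ?t) Q"
    using 1 t unfolding runs_def by blast
next
  assume *: "?t \<le> T \<and> runs q \<rho> (\<mu>(eval e1 (\<rho>, \<mu>) := eval e2 (\<rho>, \<mu>))) (T - ?t) Q"
  show "runs (Store e1 e2 ;; q) \<rho> \<mu> T Q"
    by (rule runs_Seq[where ta = "?t" and tb = "T - ?t" and
          P = "\<lambda>\<rho>' \<mu>'. \<mu>' = \<mu>(eval e1 (\<rho>, \<mu>) := eval e2 (\<rho>, \<mu>)) \<and> \<rho>' = \<rho>"]) (use * in auto)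
qed

lemma runs_Cond:
  assumes "eval e (\<rho>, \<mu>) \<noteq> 0 \<Longrightarrow> runs p \<rho> \<mu> T' Q" "eval e (\<rho>, \<mu>) = 0 \<Longrightarrow> runs q \<rho> \<mu> T' Q"
    and "eval_time e + 1 + T' \<le> T"
  shows "runs (Cond e p q) \<rho> \<mu> T Q"
proof (cases "eval e (\<rho>, \<mu>) = 0")
  case True
  then obtain t \<rho>' \<mu>' where q: "exec q (\<rho>, \<mu>) t (\<rho>', \<mu>')" "t \<le> T'" "Q \<rho>' \<mu>'"
    using assms(2) unfolding runs_def by blast
  have "eval_time e + 1 + t \<le> T" using q(2) assms(3) by linarith
  thus ?thesis using exec_Cond_False[OF True q(1)] q(3) unfolding runs_def by blast
next
  case False
  then obtain t \<rho>' \<mu>' where q: "exec p (\<rho>, \<mu>) t (\<rho>', \<mu>')" "t \<le> T'" "Q \<rho>' \<mu>'"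
    using assms(1) unfolding runs_def by blast
  have "eval_time e + 1 + t \<le> T" using q(2) assms(3) by linarith
  thus ?thesis using exec_Cond_True[OF False q(1)] q(3) unfolding runs_def by blast
qed

text \<open>The index k of the invariant is at once the variant and a bound on the remaining
  iterations. It may drop by more than one, as the potential does not rise by a fixed
  amount.\<close>

lemma runs_While:
  assumes body: "\<And>k \<rho> \<mu>. I k \<rho> \<mu> \<Longrightarrow> eval e (\<rho>, \<mu>) \<noteq> 0 \<Longrightarrow>
      runs p \<rho> \<mu> Tb (\<lambda>\<rho>' \<mu>'. \<exists>k'<k. I k' \<rho>' \<mu>')"
    and exit: "\<And>k \<rho> \<mu>. I k \<rho> \<mu> \<Longrightarrow> eval e (\<rho>, \<mu>) = 0 \<Longrightarrow> Q \<rho> \<mu>"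
    and I: "I (k :: nat) \<rho> \<mu>" and T: "eval_time e + 1 + k * (Tb + eval_time e + 1) \<le> T"
  shows "runs (While e p) \<rho> \<mu> T Q"
  using I T
proof (induction k arbitrary: \<rho> \<mu> T rule: less_induct)
  case (less k)
  show ?case
  proof (cases "eval e (\<rho>, \<mu>) = 0")
    case True
    have "eval_time e + 1 \<le> T" using less.prems(2) by linarith
    thus ?thesis
      using exec_While_False[of e "(\<rho>, \<mu>)" p, OF True] exit[OF less.prems(1) True]
      unfolding runs_def by blast
  next
    case False
    obtain t \<rho>' \<mu>' k' where p: "exec p (\<rho>, \<mu>) t (\<rho>', \<mu>')" "t \<le> Tb" "k' < k" "I k' \<rho>' \<mu>'"
      using body[OF less.prems(1) False] unfolding runs_def by blast
    obtain t' \<rho>'' \<mu>'' where w: "exec (While e p) (\<rho>', \<mu>') t' (\<rho>'', \<mu>'')"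
      "t' \<le> eval_time e + 1 + k' * (Tb + eval_time e + 1)" "Q \<rho>'' \<mu>''"
      using less.IH[OF p(3,4) le_refl] unfolding runs_def by blast
    have "Suc k' * (Tb + eval_time e + 1) \<le> k * (Tb + eval_time e + 1)"
      using p(3) by (intro mult_right_mono) auto
    hence "eval_time e + 1 + t + t' \<le> T"
      using less.prems(2) p(2) w(2) by simp
    thus ?thesis
      using exec_While_True[of e "(\<rho>, \<mu>)", OF False p(1) w(1)] w(3) unfolding runs_def by blast
  qed
qed

definition countdown :: "nat \<Rightarrow> com \<Rightarrow> com" where
  "countdown x p = While (Reg x) (p ;; Assign x (Minus (Reg x) (Const 1)))"

text \<open>The overhead of 6 per round is 2 for the test and 4 for the decrement; the leading 2 is
  the final failing test. The body runs with counter values k, ..., 1, matching vertices and edges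
  numbered from 1.\<close>

lemma runs_countdown:
  assumes I: "I k \<rho> \<mu>" and reg: "\<And>k \<rho> \<mu>. I k \<rho> \<mu> \<Longrightarrow> \<rho> x = k"
    and body: "\<And>k \<rho> \<mu>. I (Suc k) \<rho> \<mu> \<Longrightarrow>
      runs p \<rho> \<mu> Tb (\<lambda>\<rho>' \<mu>'. \<rho>' x = Suc k \<and> I k (\<rho>'(x := k)) \<mu>')"
    and exit: "\<And>\<rho> \<mu>. I 0 \<rho> \<mu> \<Longrightarrow> Q \<rho> \<mu>"
    and T: "2 + k * (Tb + 6) \<le> T"
  shows "runs (countdown x p) \<rho> \<mu> T Q"
  unfolding countdown_def
proof (rule runs_While[where I = I and k = k and Tb = "Tb + 4"])
  fix k \<rho> \<mu> assume k: "I k \<rho> \<mu>" "eval (Reg x) (\<rho>, \<mu>) \<noteq> 0"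
  then obtain k' where k': "k = Suc k'"
    using reg[OF k(1)] by (cases k) auto
  show "runs (p ;; Assign x (Minus (Reg x) (Const 1))) \<rho> \<mu> (Tb + 4) (\<lambda>\<rho>' \<mu>'. \<exists>k'<k. I k' \<rho>' \<mu>')"
    by (rule runs_Seq[OF body[OF k(1)[unfolded k']], where tb = 4]) (auto simp: k')
next
  fix k \<rho> \<mu> assume k: "I k \<rho> \<mu>" "eval (Reg x) (\<rho>, \<mu>) = 0"
  thus "Q \<rho> \<mu>" using reg[OF k(1)] exit by auto
qed (use I T in \<open>auto simp: algebra_simps\<close>)


section \<open>The push-relabel program\<close>

text \<open>Roles of the registers: number of vertices, row width, base address, number of edges, active vertex,
  counter, row address, target of a push, outer counter.\<close>

abbreviation (input) "rN \<equiv> 2 :: nat"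
abbreviation (input) "rW \<equiv> 3 :: nat"
abbreviation (input) "rB \<equiv> 4 :: nat"
abbreviation (input) "rM \<equiv> 5 :: nat"
abbreviation (input) "rA \<equiv> 6 :: nat"
abbreviation (input) "rX \<equiv> 7 :: nat"
abbreviation (input) "rP \<equiv> 8 :: nat"
abbreviation (input) "rT \<equiv> 9 :: nat"
abbreviation (input) "rK \<equiv> 10 :: nat"

text \<open>Multiplies the row number by the row width through repeated addition.\<close>

definition row :: "exp \<Rightarrow> com" where
  "row e = Assign rX e ;; Assign rP (Reg rB) ;; countdown rX (Assign rP (Plus (Reg rP) (Reg rW)))"

definition prepare :: com where
  "prepare = Assign rN (Plus (Mem (Const 0)) (Mem (Const 1))) ;; Assign rW (Plus (Reg rN) (Const 1)) ;;
    Assign rM (Mem (Const 2)) ;;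
    Assign rB (Plus (Plus (Const 3) (Reg rN)) (Plus (Reg rM) (Reg rM)))"

definition init_balances :: com where
  "init_balances = Assign rX (Reg rN) ;; countdown rX
     (Cond (Minus (Reg rX) (Mem (Const 0)))
       (Store (Plus (Const 2) (Reg rX)) (Minus (Reg rM) (Mem (Plus (Const 2) (Reg rX)))))
       (Store (Plus (Const 2) (Reg rX)) (Plus (Reg rM) (Mem (Plus (Const 2) (Reg rX))))))"

text \<open>Counting from 1, the k-th edge occupies the input cells n + 2k + 1 and n + 2k + 2. Cell
  0 holds l, which turns the index j of a right vertex into the vertex number l + j.\<close>

definition load_edges :: com where
  "load_edges = Assign rK (Reg rM) ;; countdown rK
     (row (Mem (Plus (Reg rN) (Plus (Plus (Reg rK) (Reg rK)) (Const 1)))) ;;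
      Store (Plus (Reg rP) (Plus (Mem (Const 0)) (Mem (Plus (Reg rN) (Plus (Plus (Reg rK) (Reg rK)) (Const 2))))))
        (Const 1))"

text \<open>The search never stops early; later hits overwrite earlier ones. The answer 0 means that
  there is no hit, since vertices are numbered from 1.\<close>

definition scan :: "nat \<Rightarrow> exp \<Rightarrow> exp \<Rightarrow> com" where
  "scan q e1 e2 = Assign q (Const 0) ;; Assign rX (Reg rN) ;;
     countdown rX (Cond e1 (Cond e2 (Assign q (Reg rX)) Skip) Skip)"

definition find_active :: com where
  "find_active = scan rA (Minus (Mem (Plus (Const 2) (Reg rX))) (Reg rM))
     (Minus (Reg rN) (Mem (Plus (Reg rB) (Reg rX))))"

definition find_arc :: com where
  "find_arc = scan rT (Mem (Plus (Reg rP) (Reg rX)))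
     (Minus (Mem (Plus (Reg rB) (Reg rA))) (Mem (Plus (Reg rB) (Reg rX))))"

definition push_com :: com where
  "push_com =
    Store (Plus (Const 2) (Reg rA)) (Minus (Mem (Plus (Const 2) (Reg rA))) (Const 1)) ;;
    Store (Plus (Const 2) (Reg rT)) (Plus (Mem (Plus (Const 2) (Reg rT))) (Const 1)) ;;
    Store (Plus (Reg rP) (Reg rT)) (Const 0) ;;
    row (Reg rT) ;;
    Store (Plus (Reg rP) (Reg rA)) (Const 1)"

definition relabel_com :: com where
  "relabel_com = Store (Plus (Reg rB) (Reg rA)) (Plus (Mem (Plus (Reg rB) (Reg rA))) (Const 1))"

definition push_relabel_step :: com where
  "push_relabel_step = row (Reg rA) ;; find_arc ;; Cond (Reg rT) push_com relabel_com"

text \<open>The initial value 1 is a dummy that lets the loop be entered; the search at the head of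
  the body replaces it. The last iteration finds no active vertex and only clears the
  register.\<close>

definition main_loop :: com where
  "main_loop = Assign rA (Const 1) ;; While (Reg rA) (find_active ;; Cond (Reg rA) push_relabel_step Skip)"

definition sum_excess :: com where
  "sum_excess = Assign rX (Reg rN) ;;
    countdown rX (Assign 0 (Plus (Reg 0) (Minus (Mem (Plus (Const 2) (Reg rX))) (Reg rM)))) ;;
    Assign 0 (Plus (Reg 0) (Reg 0))"

text \<open>Without edges the time bound is constant, so not even one pass over the vertices is
  affordable. Register 0 then already holds the correct answer 0.\<close>

definition discrepancy_com :: com where
  "discrepancy_com = Cond (Mem (Const 2))
     (prepare ;; init_balances ;; load_edges ;; main_loop ;; sum_excess) Skip"

section \<open>Time bounds for row addressing and linear search\<close>

lemma runs_row:
  assumes "eval e (\<rho>, \<mu>) = v" "v \<le> n" "eval_time e + 5 + 10 * n \<le> T"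
    and "Q (\<rho>(rP := \<rho> rB + v * \<rho> rW, rX := 0)) \<mu>"
  shows "runs (row e) \<rho> \<mu> T Q"
proof -
  define I where "I k \<rho>' \<mu>' \<longleftrightarrow> \<mu>' = \<mu> \<and> (\<exists>j. j + k = v \<and> \<rho>' = \<rho>(rP := \<rho> rB + j * \<rho> rW, rX := k))"
    for k \<rho>' \<mu>'
  have loop: "runs (countdown rX (Assign rP (Plus (Reg rP) (Reg rW)))) (\<rho>(rX := v, rP := \<rho> rB)) \<mu> T' Q"
    if "2 + 10 * n \<le> T'" for T'
  proof (rule runs_countdown[where k = v and Tb = 4 and I = I])
    fix k \<rho>' \<mu>' assume "I (Suc k) \<rho>' \<mu>'"
    then obtain j where j: "\<mu>' = \<mu>" "Suc j + k = v" "\<rho>' = \<rho>(rP := \<rho> rB + j * \<rho> rW, rX := Suc k)"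
      by (auto simp: I_def)
    have "I k (\<rho>(rP := \<rho> rB + Suc j * \<rho> rW, rX := k)) \<mu>"
      unfolding I_def using j(2) by blast
    moreover have "\<rho>'(rP := \<rho>' rP + \<rho>' rW, rX := k) = \<rho>(rP := \<rho> rB + Suc j * \<rho> rW, rX := k)"
      by (auto simp: j(3) fun_eq_iff)
    ultimately show "runs (Assign rP (Plus (Reg rP) (Reg rW))) \<rho>' \<mu>' 4
        (\<lambda>\<rho>' \<mu>'. \<rho>' rX = Suc k \<and> I k (\<rho>'(rX := k)) \<mu>')"
      using j(1,3) by simp
  next
    show "I v (\<rho>(rX := v, rP := \<rho> rB)) \<mu>"
      by (auto simp: I_def fun_eq_iff)
  next
    have "v * 10 \<le> n * 10" using assms(2) by simp
    thus "2 + v * (4 + 6) \<le> T'" using that by simp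
  qed (use assms(4) in \<open>auto simp: I_def\<close>)
  thus ?thesis
    using assms(1,3) by (auto simp: row_def intro!: loop)
qed

text \<open>The test is required for every value f of the result register, because that register
  changes between the rounds of the loop.\<close>

lemma runs_scan:
  assumes q: "q \<noteq> rX" "q \<noteq> rN" and n: "\<rho> rN = n"
    and test: "\<And>x f. x \<in> {1..n} \<Longrightarrow> eval e1 (\<rho>(q := f, rX := x), \<mu>) \<noteq> 0 \<and>
        eval e2 (\<rho>(q := f, rX := x), \<mu>) \<noteq> 0 \<longleftrightarrow> P x"
    and T: "6 + (eval_time e1 + eval_time e2 + 10) * n \<le> T"
    and Q: "\<And>f. \<lbrakk>f = 0 \<Longrightarrow> \<forall>x\<in>{1..n}. \<not> P x; f \<noteq> 0 \<Longrightarrow> f \<in> {1..n} \<and> P f\<rbrakk> \<Longrightarrow>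
        Q (\<rho>(q := f, rX := 0)) \<mu>"
  shows "runs (scan q e1 e2) \<rho> \<mu> T Q"
proof -
  define I where "I k \<rho>' \<mu>' \<longleftrightarrow> k \<le> n \<and> \<mu>' = \<mu> \<and> (\<exists>f. \<rho>' = \<rho>(q := f, rX := k) \<and>
      (f = 0 \<longrightarrow> (\<forall>x\<in>{k<..n}. \<not> P x)) \<and> (f \<noteq> 0 \<longrightarrow> f \<in> {1..n} \<and> P f))" for k \<rho>' \<mu>'
  have loop: "runs (countdown rX (Cond e1 (Cond e2 (Assign q (Reg rX)) Skip) Skip))
      (\<rho>(q := 0, rX := n)) \<mu> T' Q"
    if "2 + (eval_time e1 + eval_time e2 + 10) * n \<le> T'" for T'
  proof (rule runs_countdown[where k = n and I = I and Tb = "eval_time e1 + eval_time e2 + 4"])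
    fix k \<rho>' \<mu>'
    assume "I (Suc k) \<rho>' \<mu>'"
    then obtain f where f: "Suc k \<le> n" "\<mu>' = \<mu>" "\<rho>' = \<rho>(q := f, rX := Suc k)"
      "f = 0 \<longrightarrow> (\<forall>x\<in>{Suc k<..n}. \<not> P x)" "f \<noteq> 0 \<longrightarrow> f \<in> {1..n} \<and> P f"
      unfolding I_def by blast
    have test': "eval e1 (\<rho>', \<mu>') \<noteq> 0 \<and> eval e2 (\<rho>', \<mu>') \<noteq> 0 \<longleftrightarrow> P (Suc k)"
      using test[of "Suc k" f] f by simp
    have 1: "I k (\<rho>'(q := Suc k, rX := k)) \<mu>'" if "P (Suc k)"
      unfolding I_def using f that q by (intro conjI exI[of _ "Suc k"]) (auto simp: fun_eq_iff)
    have 2: "I k (\<rho>'(rX := k)) \<mu>'" if "\<not> P (Suc k)"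
    proof -
      have "\<forall>x\<in>{k<..n}. \<not> P x" if "f = 0"
        using that f(4) \<open>\<not> P (Suc k)\<close> by (metis Suc_lessI greaterThanAtMost_iff)
      thus ?thesis
        unfolding I_def using f by (intro conjI exI[of _ f]) auto
    qed
    have reg: "\<rho>' rX = Suc k" using f by simp
    show "runs (Cond e1 (Cond e2 (Assign q (Reg rX)) Skip) Skip) \<rho>' \<mu>'
        (eval_time e1 + eval_time e2 + 4) (\<lambda>\<rho>' \<mu>'. \<rho>' rX = Suc k \<and> I k (\<rho>'(rX := k)) \<mu>')"
      using test' 1 2 reg q
      by (intro runs_Cond[where T' = "eval_time e2 + 3"] runs_Cond[where T' = 2]) auto
  next
    fix \<rho>' \<mu>'
    assume "I 0 \<rho>' \<mu>'"
    thus "Q \<rho>' \<mu>'" unfolding I_def using Q by (auto simp: Suc_le_eq)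
  next
    show "I n (\<rho>(q := 0, rX := n)) \<mu>" by (auto simp: I_def)
  next
    show "2 + n * (eval_time e1 + eval_time e2 + 4 + 6) \<le> T'"
      using that by (simp add: algebra_simps)
  qed (auto simp: I_def)
  thus ?thesis
    using T q n by (auto simp: scan_def intro!: loop)
qed

lemma length_concat_pairs: "length (concat (map (\<lambda>(i, j). [i, j]) es)) = 2 * length es"
  by (induction es) auto

lemma nth_concat_pairs:
  assumes "k < length es"
  shows "concat (map (\<lambda>(i, j). [i, j]) es) ! (2 * k) = fst (es ! k)"
    and "concat (map (\<lambda>(i, j). [i, j]) es) ! Suc (2 * k) = snd (es ! k)"
proof -
  have "concat (map (\<lambda>(i, j). [i, j]) es) ! (2 * k) = fst (es ! k) \<and>
    concat (map (\<lambda>(i, j). [i, j]) es) ! Suc (2 * k) = snd (es ! k)"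
    using assms
  proof (induction es arbitrary: k)
    case (Cons e es)
    thus ?case by (cases k; cases e) auto
  qed simp
  thus "concat (map (\<lambda>(i, j). [i, j]) es) ! (2 * k) = fst (es ! k)"
    "concat (map (\<lambda>(i, j). [i, j]) es) ! Suc (2 * k) = snd (es ! k)" by auto
qed

section \<open>Memory layout and its relation to graphs and labels\<close>

locale discrepancy_input = discrepancy_instance +
  fixes es :: "(nat \<times> nat) list"
  assumes distinct_es: "distinct es" and edge_set_es: "edge_set es = E"
begin

abbreviation "n \<equiv> l + r"
abbreviation "m \<equiv> length es"

text \<open>The length of the input: the label row and the matrix lie in cells that are initially 0,
  so nothing has to be cleared.\<close>

definition base :: nat where
  "base = 3 + n + 2 * m"

text \<open>Cell \<open>cell x y\<close> holds the residual capacity from the \<open>x\<close>-th to the \<open>y\<close>-th vertex. Row 0 holds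
  the labels. The balance of the \<open>x\<close>-th vertex replaces the input in cell \<open>2 + x\<close>; it is shifted by
  the number of edges to keep it non-negative.\<close>

definition cell :: "nat \<Rightarrow> nat \<Rightarrow> nat" where
  "cell x y = base + x * Suc n + y"

definition vtx :: "nat \<Rightarrow> vertex" where
  "vtx x = (if x \<le> l then U x else V (x - l))"

text \<open>Describes memory by functions on vertex numbers alone, so that the program fragments can
  be verified without reference to graphs. Cell 0 is included because \<open>load_edges\<close>
  reads l from it.\<close>

definition grid :: "(nat \<Rightarrow> nat) \<Rightarrow> (nat \<Rightarrow> nat) \<Rightarrow> (nat \<Rightarrow> nat) \<Rightarrow> (nat \<Rightarrow> nat \<Rightarrow> bool) \<Rightarrow> bool" where
  "grid \<mu> z d R \<longleftrightarrow> \<mu> 0 = l \<and> (\<forall>x\<in>{1..n}. \<mu> (2 + x) = z x \<and> \<mu> (cell 0 x) = d x \<and>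
     (\<forall>y\<in>{1..n}. \<mu> (cell x y) = of_bool (R x y)))"

text \<open>Register 0 is kept at 0 throughout, as \<open>sum_excess\<close> accumulates the result
  there.\<close>

definition regs_ready :: "(nat \<Rightarrow> nat) \<Rightarrow> bool" where
  "regs_ready \<rho> \<longleftrightarrow> \<rho> rN = n \<and> \<rho> rW = Suc n \<and> \<rho> rB = base \<and> \<rho> rM = m \<and> \<rho> 0 = 0"

definition represents :: "(nat \<Rightarrow> nat) \<Rightarrow> (vertex \<times> vertex) set \<Rightarrow> (vertex \<Rightarrow> nat) \<Rightarrow> bool" where
  "represents \<mu> F d \<longleftrightarrow> (\<exists>z. (\<forall>x\<in>{1..n}. int (z x) = int m + excess c a F (vtx x)) \<and>
     grid \<mu> z (\<lambda>x. d (vtx x)) (\<lambda>x y. residual F (vtx x) (vtx y)))"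

lemma regs_ready_upd [simp]:
  "q \<noteq> rN \<Longrightarrow> q \<noteq> rW \<Longrightarrow> q \<noteq> rB \<Longrightarrow> q \<noteq> rM \<Longrightarrow> q \<noteq> 0 \<Longrightarrow> regs_ready (\<rho>(q := v)) \<longleftrightarrow> regs_ready \<rho>"
  by (auto simp: regs_ready_def)

lemma cell_eq_iff [simp]:
  assumes "y \<le> n" "y' \<le> n"
  shows "cell x y = cell x' y' \<longleftrightarrow> x = x' \<and> y = y'"
proof
  assume "cell x y = cell x' y'"
  hence "y + x * Suc n = y' + x' * Suc n" by (simp add: cell_def)
  hence "(y + x * Suc n) div Suc n = (y' + x' * Suc n) div Suc n"
    "(y + x * Suc n) mod Suc n = (y' + x' * Suc n) mod Suc n" by simp_all
  thus "x = x' \<and> y = y'" using assms by (simp del: mult_Suc_right)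
qed auto

lemma cell_neq [simp]: "x \<le> n \<Longrightarrow> Suc (Suc x) \<noteq> cell x' y" "x \<le> n \<Longrightarrow> cell x' y \<noteq> Suc (Suc x)"
  "cell x' y \<noteq> 0"
  by (auto simp: cell_def base_def)

lemma grid_cong:
  assumes "grid \<mu> z d R" "\<And>x. x \<in> {1..n} \<Longrightarrow> z x = z' x" "\<And>x. x \<in> {1..n} \<Longrightarrow> d x = d' x"
    "\<And>x y. x \<in> {1..n} \<Longrightarrow> y \<in> {1..n} \<Longrightarrow> R x y = R' x y"
  shows "grid \<mu> z' d' R'"
  using assms unfolding grid_def by simp

lemma grid_upd:
  assumes "grid \<mu> z d R" "x \<in> {1..n}" "y \<in> {1..n}"
  shows "grid (\<mu>(2 + x := v)) (z(x := v)) d R"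
    and "grid (\<mu>(cell 0 x := v)) z (d(x := v)) R"
    and "grid (\<mu>(cell x y := of_bool b)) z d (\<lambda>x' y'. if (x', y') = (x, y) then b else R x' y')"
  using assms unfolding grid_def by auto

lemma vtx_verts: "x \<in> {1..n} \<Longrightarrow> vtx x \<in> verts"
  by (auto simp: vtx_def left_vertices_def right_vertices_def image_iff)

lemma verts_vtx: "v \<in> verts \<Longrightarrow> \<exists>x\<in>{1..n}. v = vtx x"
proof (cases v)
  case (U i)
  assume "v \<in> verts"
  thus ?thesis using U by (intro bexI[of _ i]) (auto simp: vtx_def left_vertices_def right_vertices_def)
next
  case (V j)
  assume "v \<in> verts"
  thus ?thesis using V by (intro bexI[of _ "l + j"]) (auto simp: vtx_def left_vertices_def right_vertices_def)
qed

lemma vtx_eq_iff [simp]: "vtx x = vtx y \<longleftrightarrow> x = y"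
  by (auto simp: vtx_def)

lemma m_eq: "m = card E"
proof -
  have "inj_on (\<lambda>(i, j). (U i, V j)) (set es)" by (auto simp: inj_on_def)
  thus ?thesis
    using distinct_card[OF distinct_es] edge_set_es by (metis card_image edge_set_def)
qed

section \<open>A single push or relabelling in memory\<close>

lemma runs_find_active:
  assumes "regs_ready \<rho>" "grid \<mu> z d R" "10 + 30 * n \<le> T"
    and "\<And>f. \<lbrakk>f = 0 \<Longrightarrow> \<forall>x\<in>{1..n}. \<not> (m < z x \<and> d x < n);
        f \<noteq> 0 \<Longrightarrow> f \<in> {1..n} \<and> m < z f \<and> d f < n\<rbrakk> \<Longrightarrow> Q (\<rho>(rA := f, rX := 0)) \<mu>"
  shows "runs find_active \<rho> \<mu> T Q"
  unfolding find_active_def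
proof (rule runs_scan[where n = n and P = "\<lambda>x. m < z x \<and> d x < n"])
  fix x f assume "x \<in> {1..n}"
  thus "eval (Minus (Mem (Plus (Const 2) (Reg rX))) (Reg rM)) (\<rho>(rA := f, rX := x), \<mu>) \<noteq> 0 \<and>
      eval (Minus (Reg rN) (Mem (Plus (Reg rB) (Reg rX)))) (\<rho>(rA := f, rX := x), \<mu>) \<noteq> 0 \<longleftrightarrow>
      m < z x \<and> d x < n"
    using assms(1,2) by (auto simp: grid_def regs_ready_def cell_def)
qed (use assms in \<open>auto simp: regs_ready_def\<close>)

lemma runs_find_arc:
  assumes "regs_ready \<rho>" "grid \<mu> z d R" "10 + 30 * n \<le> T"
    and x: "\<rho> rA = x" "\<rho> rP = cell x 0" "x \<in> {1..n}"
    and "\<And>f. \<lbrakk>f = 0 \<Longrightarrow> \<forall>y\<in>{1..n}. \<not> (R x y \<and> d y < d x);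
        f \<noteq> 0 \<Longrightarrow> f \<in> {1..n} \<and> R x f \<and> d f < d x\<rbrakk> \<Longrightarrow> Q (\<rho>(rT := f, rX := 0)) \<mu>"
  shows "runs find_arc \<rho> \<mu> T Q"
  unfolding find_arc_def
proof (rule runs_scan[where n = n and P = "\<lambda>y. R x y \<and> d y < d x"])
  fix y f assume y: "y \<in> {1..n}"
  have "\<mu> (cell x 0 + y) = of_bool (R x y)" "\<mu> (base + x) = d x" "\<mu> (base + y) = d y"
    using assms(2) x y by (auto simp: grid_def cell_def add.assoc)
  thus "eval (Mem (Plus (Reg rP) (Reg rX))) (\<rho>(rT := f, rX := y), \<mu>) \<noteq> 0 \<and>
      eval (Minus (Mem (Plus (Reg rB) (Reg rA))) (Mem (Plus (Reg rB) (Reg rX)))) (\<rho>(rT := f, rX := y), \<mu>) \<noteq> 0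
      \<longleftrightarrow> R x y \<and> d y < d x"
    using assms(1) x by (auto simp: regs_ready_def)
qed (use assms in \<open>auto simp: regs_ready_def\<close>)

lemma cell_row: "cell x 0 + y = cell x y"
  by (simp add: cell_def)

text \<open>The assumption 0 < \<open>z x\<close> makes the truncated decrement exact. As every edge
  carries at most one unit, a push turns the residual arc around: one matrix entry is cleared and
  the transposed one is set.\<close>

lemma runs_push:
  assumes "regs_ready \<rho>" "grid \<mu> z d R" "50 + 10 * n \<le> T"
    and x: "\<rho> rA = x" "\<rho> rP = cell x 0" "x \<in> {1..n}" "0 < z x"
    and y: "\<rho> rT = y" "y \<in> {1..n}" "x \<noteq> y"
    and Q: "\<And>\<rho>' \<mu>'. \<lbrakk>regs_ready \<rho>'; \<rho>' rA = x;
      grid \<mu>' (z(x := z x - 1, y := z y + 1)) d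
        (\<lambda>u v. R u v \<and> (u, v) \<noteq> (x, y) \<or> (u, v) = (y, x))\<rbrakk> \<Longrightarrow> Q \<rho>' \<mu>'"
  shows "runs push_com \<rho> \<mu> T Q"
proof -
  define \<mu>1 where "\<mu>1 = \<mu>(2 + x := z x - 1, 2 + y := z y + 1, cell x y := of_bool False)"
  define \<rho>1 where "\<rho>1 = \<rho>(rP := base + y * Suc n, rX := 0)"
  have z: "\<mu> (2 + x) = z x" "\<mu> (2 + y) = z y"
    using assms(2) x y by (auto simp: grid_def)
  have tail: "runs (row (Reg rT) ;; Store (Plus (Reg rP) (Reg rA)) (Const 1)) \<rho> \<mu>1 T' Q"
    if "20 + 10 * n \<le> T'" for T'
  proof (rule runs_Seq[where P = "\<lambda>\<rho>' \<mu>'. \<rho>' = \<rho>1 \<and> \<mu>' = \<mu>1"])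
    show "runs (row (Reg rT)) \<rho> \<mu>1 (6 + 10 * n) (\<lambda>\<rho>' \<mu>'. \<rho>' = \<rho>1 \<and> \<mu>' = \<mu>1)"
      using assms(1) x y by (intro runs_row[where v = y and n = n]) (auto simp: \<rho>1_def regs_ready_def)
  next
    fix \<rho>' \<mu>' assume *: "\<rho>' = \<rho>1 \<and> \<mu>' = \<mu>1"
    have "grid (\<mu>1(cell y x := of_bool True)) (z(x := z x - 1, y := z y + 1)) d
        (\<lambda>u v. R u v \<and> (u, v) \<noteq> (x, y) \<or> (u, v) = (y, x))"
      unfolding \<mu>1_def
      by (rule grid_cong[OF grid_upd(3)[OF grid_upd(3)[OF grid_upd(1)[OF grid_upd(1)[OF assms(2)]]]]])
        (use x y in auto)
    hence "Q \<rho>1 (\<mu>1(cell y x := 1))"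
      using assms(1) x by (intro Q) (auto simp: \<rho>1_def)
    moreover have "base + y * Suc n + x = cell y x" by (simp add: cell_def)
    ultimately show "runs (Store (Plus (Reg rP) (Reg rA)) (Const 1)) \<rho>' \<mu>' 10 Q"
      using * x by (simp add: \<rho>1_def)
  qed (use that in auto)
  moreover have "\<mu>(2 + x := z x - 1, 2 + y := z y + 1, cell x 0 + y := 0) = \<mu>1"
    by (simp add: \<mu>1_def cell_row)
  ultimately show ?thesis
    using assms z by (auto simp: push_com_def intro!: tail)
qed

lemma runs_relabel:
  assumes "regs_ready \<rho>" "grid \<mu> z d R" "20 \<le> T" "\<rho> rA = x" "x \<in> {1..n}"
    and "grid (\<mu>(cell 0 x := Suc (d x))) z (d(x := Suc (d x))) R \<Longrightarrow> Q \<rho> (\<mu>(cell 0 x := Suc (d x)))"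
  shows "runs relabel_com \<rho> \<mu> T Q"
proof -
  have "\<mu> (base + x) = d x" "base + x = cell 0 x"
    using assms(2,5) by (auto simp: grid_def cell_def)
  thus ?thesis
    using assms grid_upd(2)[OF assms(2,5,5), of "Suc (d x)"]
    by (simp add: relabel_com_def regs_ready_def)
qed

lemma runs_step:
  assumes regs: "regs_ready \<rho>" and rep: "represents \<mu> F d" and inv: "valid_labelling F d"
    and x: "\<rho> rA = x" "x \<in> {1..n}" "0 < excess c a F (vtx x)" "d (vtx x) < n"
    and T: "100 + 50 * n \<le> T"
  shows "runs push_relabel_step \<rho> \<mu> T (\<lambda>\<rho>' \<mu>'. regs_ready \<rho>' \<and> \<rho>' rA = x \<and>
    (\<exists>F' d'. represents \<mu>' F' d' \<and> valid_labelling F' d' \<and> potential F d < potential F' d'))"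
    (is "runs _ _ _ _ ?Q")
proof -
  obtain z where z: "\<And>x. x \<in> {1..n} \<Longrightarrow> int (z x) = int m + excess c a F (vtx x)"
    and grid: "grid \<mu> z (\<lambda>x. d (vtx x)) (\<lambda>x y. residual F (vtx x) (vtx y))"
    using rep unfolding represents_def by blast
  have FE: "F \<subseteq> E" using inv by (simp add: valid_labelling_def)
  define \<rho>1 where "\<rho>1 = \<rho>(rP := cell x 0, rX := 0)"
  have \<rho>1: "regs_ready \<rho>1" "\<rho>1 rA = x" "\<rho>1 rP = cell x 0"
    using regs x(1) by (auto simp: \<rho>1_def)
  have "runs (find_arc ;; Cond (Reg rT) push_com relabel_com) \<rho>1 \<mu> (80 + 40 * n) ?Q"
  proof (rule runs_Seq[where P = "\<lambda>\<rho>' \<mu>'. \<mu>' = \<mu> \<and> (\<exists>f. \<rho>' = \<rho>1(rT := f, rX := 0) \<and>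
      (f = 0 \<longrightarrow> (\<forall>y\<in>{1..n}. \<not> (residual F (vtx x) (vtx y) \<and> d (vtx y) < d (vtx x)))) \<and>
      (f \<noteq> 0 \<longrightarrow> f \<in> {1..n} \<and> residual F (vtx x) (vtx f) \<and> d (vtx f) < d (vtx x)))"])
    show "runs find_arc \<rho>1 \<mu> (10 + 30 * n) (\<lambda>\<rho>' \<mu>'. \<mu>' = \<mu> \<and> (\<exists>f. \<rho>' = \<rho>1(rT := f, rX := 0) \<and>
      (f = 0 \<longrightarrow> (\<forall>y\<in>{1..n}. \<not> (residual F (vtx x) (vtx y) \<and> d (vtx y) < d (vtx x)))) \<and>
      (f \<noteq> 0 \<longrightarrow> f \<in> {1..n} \<and> residual F (vtx x) (vtx f) \<and> d (vtx f) < d (vtx x))))"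
      by (rule runs_find_arc[OF \<rho>1(1) grid le_refl \<rho>1(2,3) x(2)]) blast
  next
    fix \<rho>' \<mu>' assume "\<mu>' = \<mu> \<and> (\<exists>f. \<rho>' = \<rho>1(rT := f, rX := 0) \<and>
      (f = 0 \<longrightarrow> (\<forall>y\<in>{1..n}. \<not> (residual F (vtx x) (vtx y) \<and> d (vtx y) < d (vtx x)))) \<and>
      (f \<noteq> 0 \<longrightarrow> f \<in> {1..n} \<and> residual F (vtx x) (vtx f) \<and> d (vtx f) < d (vtx x)))"
    then obtain y where \<mu>': "\<mu>' = \<mu>" and \<rho>': "\<rho>' = \<rho>1(rT := y, rX := 0)"
      and none: "y = 0 \<Longrightarrow> \<forall>y\<in>{1..n}. \<not> (residual F (vtx x) (vtx y) \<and> d (vtx y) < d (vtx x))"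
      and some: "y \<noteq> 0 \<Longrightarrow> y \<in> {1..n} \<and> residual F (vtx x) (vtx y) \<and> d (vtx y) < d (vtx x)"
      by blast
    have regs': "regs_ready \<rho>'" "\<rho>' rA = x" "\<rho>' rP = cell x 0" "\<rho>' rT = y"
      using \<rho>1 by (auto simp: \<rho>')
    show "runs (Cond (Reg rT) push_com relabel_com) \<rho>' \<mu>' (60 + 10 * n) ?Q"
    proof (rule runs_Cond[where T' = "50 + 10 * n"])
      assume "eval (Reg rT) (\<rho>', \<mu>') \<noteq> 0"
      hence "y \<noteq> 0" using regs' by simp
      hence y: "y \<in> {1..n}" "residual F (vtx x) (vtx y)" "d (vtx y) < d (vtx x)" using some by auto
      \<comment> \<open>The search only establishes that y lies below x; validity makes the drop
        exactly one, as \<open>push\<close> requires.\<close>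
      have "d (vtx x) \<le> Suc (d (vtx y))"
        using inv y by (simp add: valid_labelling_def)
      hence "d (vtx x) = Suc (d (vtx y))" using y(3) by simp
      then obtain F' where F': "valid_labelling F' d" "potential F' d = Suc (potential F d)"
        "\<And>v. excess c a F' v = excess c a F v + of_bool (v = vtx y) - of_bool (v = vtx x)"
        "\<And>u v. residual F' u v \<longleftrightarrow> residual F u v \<and> (u, v) \<noteq> (vtx x, vtx y) \<or> (u, v) = (vtx y, vtx x)"
        using push[OF inv y(2) x(3)] by blast
      have xy: "x \<noteq> y" using y(3) by auto
      have zx: "0 < z x" using z[OF x(2)] x(3) by linarith
      show "runs push_com \<rho>' \<mu>' (50 + 10 * n) ?Q"
        unfolding \<mu>'
      proof (rule runs_push[OF regs'(1) grid le_refl regs'(2,3) x(2) zx regs'(4) y(1) xy])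
        fix \<rho>'' \<mu>''
        assume 1: "regs_ready \<rho>''" "\<rho>'' rA = x"
          and 2: "grid \<mu>'' (z(x := z x - 1, y := z y + 1)) (\<lambda>x. d (vtx x))
           (\<lambda>u v. residual F (vtx u) (vtx v) \<and> (u, v) \<noteq> (x, y) \<or> (u, v) = (y, x))"
        have "represents \<mu>'' F' d"
          unfolding represents_def
        proof (intro exI conjI ballI)
          show "grid \<mu>'' (z(x := z x - 1, y := z y + 1)) (\<lambda>x. d (vtx x))
             (\<lambda>u v. residual F' (vtx u) (vtx v))"
            using 2 unfolding F'(4) by simp
        next
          fix w assume w: "w \<in> {1..n}"
          show "int ((z(x := z x - 1, y := z y + 1)) w) = int m + excess c a F' (vtx w)"
            using z[OF w] xy zx by (auto simp: F'(3) of_nat_diff)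
        qed
        thus "?Q \<rho>'' \<mu>''" using 1 F'(1,2) by (auto intro!: exI[of _ F'] exI[of _ d])
      qed
    next
      assume "eval (Reg rT) (\<rho>', \<mu>') = 0"
      hence "y = 0" using regs' by simp
      \<comment> \<open>Residual neighbours are vertices of the graph, so the failed search over all
        numbers 1, ..., n has inspected each of them.\<close>
      have stuck: "d (vtx x) \<le> d v" if "residual F (vtx x) v" for v
      proof -
        have "v \<in> verts" using that FE verts_of_edge by (auto simp: residual_def)
        thus ?thesis using none[OF \<open>y = 0\<close>] that verts_vtx by (metis not_le)
      qed
      note relabel = relabel[OF inv vtx_verts[OF x(2)] x(3,4) stuck]
      show "runs relabel_com \<rho>' \<mu>' (50 + 10 * n) ?Q"
        unfolding \<mu>'
      proof (rule runs_relabel[OF regs'(1) grid _ regs'(2) x(2)])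
        let ?d = "d(vtx x := Suc (d (vtx x)))"
        assume "grid (\<mu>(cell 0 x := Suc (d (vtx x)))) z ((\<lambda>x. d (vtx x))(x := Suc (d (vtx x))))
           (\<lambda>x y. residual F (vtx x) (vtx y))"
        hence "grid (\<mu>(cell 0 x := Suc (d (vtx x)))) z (\<lambda>x. ?d (vtx x)) (\<lambda>x y. residual F (vtx x) (vtx y))"
          by (rule grid_cong) auto
        hence "represents (\<mu>(cell 0 x := Suc (d (vtx x)))) F ?d"
          unfolding represents_def using z by blast
        thus "?Q \<rho>' (\<mu>(cell 0 x := Suc (d (vtx x))))"
          using relabel regs' by blast
      qed simp
    qed simp
  qed simp
  moreover have "\<rho>1 = \<rho>(rP := \<rho> rB + x * \<rho> rW, rX := 0)"
    using regs by (simp add: \<rho>1_def regs_ready_def cell_def)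
  ultimately show ?thesis
    unfolding push_relabel_step_def using x T
    by (intro runs_Seq[OF runs_row[where v = x and n = n and
          T = "6 + 10 * n" and Q = "\<lambda>\<rho>' \<mu>'. \<rho>' = \<rho>1 \<and> \<mu>' = \<mu>"], where tb = "80 + 40 * n"]) auto
qed

section \<open>Termination of the main loop and extraction of the result\<close>

lemma runs_main_loop:
  assumes regs: "regs_ready \<rho>" and rep: "represents \<mu> {} (\<lambda>_. 0)"
    and T: "10 + (2 + 3 * n * m) * (120 + 80 * n) \<le> T"
  shows "runs main_loop \<rho> \<mu> T (\<lambda>\<rho>' \<mu>'. regs_ready \<rho>' \<and> (\<exists>F d. represents \<mu>' F d \<and>
    valid_labelling F d \<and> (\<forall>x\<in>{1..n}. 0 < excess c a F (vtx x) \<longrightarrow> n \<le> d (vtx x))))"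
    (is "runs _ _ _ _ ?Q")
proof -
  \<comment> \<open>The summand \<open>of_bool\<close> pays for the last iteration, which decreases
    k by clearing register \<open>rA\<close> instead of by raising the potential.\<close>
  define I where "I k \<rho> \<mu> \<longleftrightarrow> regs_ready \<rho> \<and> (\<exists>F d. represents \<mu> F d \<and> valid_labelling F d \<and>
      (\<rho> rA = 0 \<longrightarrow> (\<forall>x\<in>{1..n}. 0 < excess c a F (vtx x) \<longrightarrow> n \<le> d (vtx x))) \<and>
      potential F d + k = 3 * n * m + of_bool (\<rho> rA \<noteq> 0))" for k \<rho> \<mu>
  define k where "k = 3 * n * m + 1 - potential {} (\<lambda>_. 0)"
  have loop: "runs (While (Reg rA) (find_active ;; Cond (Reg rA) push_relabel_step Skip)) (\<rho>(rA := 1)) \<mu> T' ?Q"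
    if T': "2 + (2 + 3 * n * m) * (120 + 80 * n) \<le> T'" for T'
  proof (rule runs_While[where I = I and k = k and Tb = "112 + 80 * n"])
    show "I k (\<rho>(rA := 1)) \<mu>"
      unfolding I_def k_def using regs rep valid_labelling_empty potential_le[OF valid_labelling_empty]
      by (auto simp: m_eq intro!: exI[of _ "{}"] exI[of _ "\<lambda>_. 0"])
  next
    have "k * (114 + 80 * n) \<le> (1 + 3 * n * m) * (120 + 80 * n)"
      by (rule mult_le_mono) (auto simp: k_def)
    thus "eval_time (Reg rA) + 1 + k * (112 + 80 * n + eval_time (Reg rA) + 1) \<le> T'"
      using T' by (simp add: algebra_simps)
  next
    fix k \<rho> \<mu> assume "I k \<rho> \<mu>" "eval (Reg rA) (\<rho>, \<mu>) = 0"
    thus "?Q \<rho> \<mu>" by (auto simp: I_def)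
  next
    fix k \<rho> \<mu> assume I: "I k \<rho> \<mu>" and A: "eval (Reg rA) (\<rho>, \<mu>) \<noteq> 0"
    then obtain F d where regs: "regs_ready \<rho>" and rep: "represents \<mu> F d"
      and inv: "valid_labelling F d" and pot: "potential F d + k = 3 * n * m + 1"
      unfolding I_def by auto
    obtain z where z: "\<And>x. x \<in> {1..n} \<Longrightarrow> int (z x) = int m + excess c a F (vtx x)"
      and grid: "grid \<mu> z (\<lambda>x. d (vtx x)) (\<lambda>x y. residual F (vtx x) (vtx y))"
      using rep unfolding represents_def by blast
    have mz: "m < z x \<longleftrightarrow> 0 < excess c a F (vtx x)" if "x \<in> {1..n}" for x
      using z[OF that] by linarith
    have k0: "0 < k"
      using pot potential_le[OF inv, folded m_eq] by linarith
    show "runs (find_active ;; Cond (Reg rA) push_relabel_step Skip) \<rho> \<mu> (112 + 80 * n)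
       (\<lambda>\<rho>' \<mu>'. \<exists>k'<k. I k' \<rho>' \<mu>')"
    proof (rule runs_Seq[where P = "\<lambda>\<rho>' \<mu>'. \<mu>' = \<mu> \<and> regs_ready \<rho>' \<and>
        (\<rho>' rA = 0 \<longrightarrow> (\<forall>x\<in>{1..n}. \<not> (m < z x \<and> d (vtx x) < n))) \<and>
        (\<rho>' rA \<noteq> 0 \<longrightarrow> \<rho>' rA \<in> {1..n} \<and> m < z (\<rho>' rA) \<and> d (vtx (\<rho>' rA)) < n)"])
      show "runs find_active \<rho> \<mu> (10 + 30 * n) (\<lambda>\<rho>' \<mu>'. \<mu>' = \<mu> \<and> regs_ready \<rho>' \<and>
        (\<rho>' rA = 0 \<longrightarrow> (\<forall>x\<in>{1..n}. \<not> (m < z x \<and> d (vtx x) < n))) \<and>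
        (\<rho>' rA \<noteq> 0 \<longrightarrow> \<rho>' rA \<in> {1..n} \<and> m < z (\<rho>' rA) \<and> d (vtx (\<rho>' rA)) < n))"
        by (rule runs_find_active[OF regs grid le_refl]) (use regs in auto)
    next
      fix \<rho>' \<mu>'
      assume *: "\<mu>' = \<mu> \<and> regs_ready \<rho>' \<and>
        (\<rho>' rA = 0 \<longrightarrow> (\<forall>x\<in>{1..n}. \<not> (m < z x \<and> d (vtx x) < n))) \<and>
        (\<rho>' rA \<noteq> 0 \<longrightarrow> \<rho>' rA \<in> {1..n} \<and> m < z (\<rho>' rA) \<and> d (vtx (\<rho>' rA)) < n)"
      show "runs (Cond (Reg rA) push_relabel_step Skip) \<rho>' \<mu>' (102 + 50 * n) (\<lambda>\<rho>' \<mu>'. \<exists>k'<k. I k' \<rho>' \<mu>')"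
      proof (rule runs_Cond[where T' = "100 + 50 * n"])
        assume "eval (Reg rA) (\<rho>', \<mu>') \<noteq> 0"
        hence x: "\<rho>' rA \<in> {1..n}" "0 < excess c a F (vtx (\<rho>' rA))" "d (vtx (\<rho>' rA)) < n"
          using * mz by auto
        have "runs push_relabel_step \<rho>' \<mu> (100 + 50 * n) (\<lambda>\<rho>'' \<mu>''. regs_ready \<rho>'' \<and> \<rho>'' rA = \<rho>' rA \<and>
          (\<exists>F' d'. represents \<mu>'' F' d' \<and> valid_labelling F' d' \<and> potential F d < potential F' d'))"
          using * x by (intro runs_step[where F = F and d = d, OF _ rep inv]) auto
        moreover have "\<exists>k'<k. I k' \<rho>'' \<mu>''" if 1: "regs_ready \<rho>''" "\<rho>'' rA = \<rho>' rA"
          and 2: "represents \<mu>'' F' d'" "valid_labelling F' d'" "potential F d < potential F' d'"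
          for \<rho>'' \<mu>'' F' d'
        proof (intro exI conjI)
          have "potential F' d' \<le> 3 * n * m"
            using potential_le[OF 2(2)] by (simp add: m_eq)
          thus "I (3 * n * m + 1 - potential F' d') \<rho>'' \<mu>''"
            unfolding I_def using 1 2 x(1) by (auto intro!: exI[of _ F'] exI[of _ d'])
          show "3 * n * m + 1 - potential F' d' < k"
            using 2(3) pot k0 by linarith
        qed
        ultimately show "runs push_relabel_step \<rho>' \<mu>' (100 + 50 * n) (\<lambda>\<rho>' \<mu>'. \<exists>k'<k. I k' \<rho>' \<mu>')"
          using * by (elim conjE) (auto elim!: runs_mono)
      next
        assume "eval (Reg rA) (\<rho>', \<mu>') = 0"
        hence A0: "\<rho>' rA = 0" by simp
        have "\<forall>x\<in>{1..n}. 0 < excess c a F (vtx x) \<longrightarrow> n \<le> d (vtx x)"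
          using * A0 mz by auto
        hence "I (k - 1) \<rho>' \<mu>"
          unfolding I_def using * rep inv pot k0 A0 by (auto intro!: exI[of _ F] exI[of _ d])
        hence "\<exists>k'<k. I k' \<rho>' \<mu>" using k0 by (intro exI[of _ "k - 1"]) auto
        thus "runs Skip \<rho>' \<mu>' (100 + 50 * n) (\<lambda>\<rho>' \<mu>'. \<exists>k'<k. I k' \<rho>' \<mu>')" using * by simp
      qed simp
    qed simp
  qed
  show ?thesis
    using T by (auto simp: main_loop_def simp del: One_nat_def intro!: loop)
qed

lemma sum_vtx: "(\<Sum>v\<in>verts. h v) = (\<Sum>x=1..n. h (vtx x))"
proof -
  have "verts = vtx ` {1..n}"
    using vtx_verts verts_vtx by blast
  thus ?thesis by (simp add: sum.reindex inj_on_def)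
qed

lemma runs_sum_excess:
  assumes regs: "regs_ready \<rho>" and rep: "represents \<mu> F d" and T: "10 + 20 * n \<le> T"
  shows "runs sum_excess \<rho> \<mu> T (\<lambda>\<rho>' \<mu>'. int (\<rho>' 0) = 2 * total_excess l r c a F)"
proof -
  \<comment> \<open>Truncated subtraction of the shift m yields exactly the positive part of the
    excess.\<close>
  define X where "X k = (\<Sum>x\<in>{k<..n}. \<mu> (2 + x) - m)" for k
  have X: "X k = \<mu> (2 + Suc k) - m + X (Suc k)" if "Suc k \<le> n" for k
  proof -
    have "{k<..n} = insert (Suc k) {Suc k<..n}" using that by auto
    thus ?thesis by (simp add: X_def)
  qed
  have "int (X 0) = (\<Sum>x=1..n. max 0 (excess c a F (vtx x)))"
    unfolding X_def of_nat_sum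
  proof (rule sum.cong)
    fix x assume "x \<in> {1..n}"
    hence "int (\<mu> (2 + x)) = int m + excess c a F (vtx x)"
      using rep by (auto simp: represents_def grid_def)
    thus "int (\<mu> (2 + x) - m) = max 0 (excess c a F (vtx x))" by linarith
  qed auto
  hence X0: "int (X 0) = total_excess l r c a F"
    by (simp add: total_excess_def sum_vtx)
  let ?I = "\<lambda>k \<rho>' \<mu>'. k \<le> n \<and> \<mu>' = \<mu> \<and> \<rho>' rX = k \<and> \<rho>' rM = m \<and> \<rho>' 0 = X k"
  have body: "runs (countdown rX (Assign 0 (Plus (Reg 0) (Minus (Mem (Plus (Const 2) (Reg rX))) (Reg rM)))))
      (\<rho>(rX := n)) \<mu> (2 + 20 * n) (\<lambda>\<rho>' \<mu>'. \<rho>' 0 = X 0)"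
    by (rule runs_countdown[where k = n and Tb = 12 and I = ?I])
      (use regs X in \<open>auto simp: regs_ready_def X_def\<close>)
  have loop: "runs (countdown rX (Assign 0 (Plus (Reg 0) (Minus (Mem (Plus (Const 2) (Reg rX))) (Reg rM)))) ;;
      Assign 0 (Plus (Reg 0) (Reg 0))) (\<rho>(rX := n)) \<mu> T' (\<lambda>\<rho>' \<mu>'. int (\<rho>' 0) = 2 * total_excess l r c a F)"
    if "6 + 20 * n \<le> T'" for T'
    by (rule runs_Seq[OF body, where tb = 4]) (use that X0 in auto)
  show ?thesis
    using T regs by (auto simp: sum_excess_def regs_ready_def intro!: loop)
qed

section \<open>Decoding the input and building the initial memory\<close>

definition input_mem :: "nat \<Rightarrow> nat" where
  "input_mem = snd (initial_state (input_list l r es c a))"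

lemma input_mem_simps:
  "input_mem 0 = l" "input_mem (Suc 0) = r" "input_mem 2 = m"
  "x \<in> {1..l} \<Longrightarrow> input_mem (2 + x) = c x"
  "x \<in> {1..r} \<Longrightarrow> input_mem (2 + (l + x)) = a x"
  "k < m \<Longrightarrow> input_mem (3 + n + 2 * k) = fst (es ! k)"
  "k < m \<Longrightarrow> input_mem (4 + n + 2 * k) = snd (es ! k)"
  "base \<le> p \<Longrightarrow> input_mem p = 0"
proof -
  let ?cs = "map c [1..<Suc l]" and ?as = "map a [1..<Suc r]" and ?es = "concat (map (\<lambda>(i, j). [i, j]) es)"
  let ?inp = "[l, r, m] @ ?cs @ ?as @ ?es"
  have len: "length ?inp = base"
    by (simp add: base_def length_concat_pairs)
  have mem: "input_mem p = (if p < base then ?inp ! p else 0)" for p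
    unfolding input_mem_def initial_state_def input_list_def snd_conv len ..
  show "input_mem 0 = l" "input_mem (Suc 0) = r" "input_mem 2 = m"
    unfolding mem by (simp_all add: base_def)
  show "input_mem (2 + x) = c x" if "x \<in> {1..l}"
  proof -
    have "?inp ! (2 + x) = (?cs @ ?as @ ?es) ! (x - 1)"
      using that by (cases x) auto
    also have "\<dots> = c x"
      using that by (auto simp: nth_append simp del: upt_Suc)
    finally show ?thesis using that by (simp add: mem base_def)
  qed
  show "input_mem (2 + (l + x)) = a x" if "x \<in> {1..r}"
  proof -
    have "?inp ! (2 + (l + x)) = (?cs @ ?as @ ?es) ! (l + (x - 1))"
      using that by (cases x) auto
    also have "\<dots> = a x"
      using that by (auto simp: nth_append simp del: upt_Suc)
    finally show ?thesis using that by (simp add: mem base_def)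
  qed
  show "input_mem (3 + n + 2 * k) = fst (es ! k)" "input_mem (4 + n + 2 * k) = snd (es ! k)" if "k < m"
  proof -
    have *: "?inp ! (3 + n + q) = ?es ! q" for q
      by (simp add: nth_append numeral_3_eq_3 del: upt_Suc)
    show "input_mem (3 + n + 2 * k) = fst (es ! k)"
      using that *[of "2 * k"] nth_concat_pairs[OF that] unfolding mem by (simp add: base_def)
    have "4 + n + 2 * k = 3 + n + Suc (2 * k)" by simp
    thus "input_mem (4 + n + 2 * k) = snd (es ! k)"
      using that *[of "Suc (2 * k)"] nth_concat_pairs[OF that] unfolding mem by (simp add: base_def)
  qed
  show "input_mem p = 0" if "base \<le> p" using that by (simp add: mem)
qed

definition balanced_mem :: "nat \<Rightarrow> nat" where
  "balanced_mem p = (if 2 < p \<and> p \<le> 2 + n then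
     (if p \<le> 2 + l then m + input_mem p else m - input_mem p) else input_mem p)"

lemma runs_prepare:
  assumes "30 \<le> T"
  shows "runs prepare (\<lambda>_. 0) input_mem T (\<lambda>\<rho>' \<mu>'. regs_ready \<rho>' \<and> \<mu>' = input_mem)"
  using assms by (auto simp: prepare_def regs_ready_def input_mem_simps base_def)

lemma runs_init_balances:
  assumes regs: "regs_ready \<rho>" and T: "10 + 30 * n \<le> T"
  shows "runs init_balances \<rho> input_mem T (\<lambda>\<rho>' \<mu>'. regs_ready \<rho>' \<and> \<mu>' = balanced_mem)"
proof -
  \<comment> \<open>The loop runs downwards, so the cells beyond 2 + k are converted and the
    remaining ones still hold the input.\<close>
  let ?I = "\<lambda>k \<rho>' \<mu>'. k \<le> n \<and> regs_ready \<rho>' \<and> \<rho>' rX = k \<and>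
    \<mu>' = (\<lambda>p. if 2 + k < p then balanced_mem p else input_mem p)"
  have loop: "runs (countdown rX
     (Cond (Minus (Reg rX) (Mem (Const 0)))
       (Store (Plus (Const 2) (Reg rX)) (Minus (Reg rM) (Mem (Plus (Const 2) (Reg rX)))))
       (Store (Plus (Const 2) (Reg rX)) (Plus (Reg rM) (Mem (Plus (Const 2) (Reg rX)))))))
     (\<rho>(rX := n)) input_mem T' (\<lambda>\<rho>' \<mu>'. regs_ready \<rho>' \<and> \<mu>' = balanced_mem)"
    if T': "2 + 30 * n \<le> T'" for T'
  proof (rule runs_countdown[where k = n and Tb = 18 and I = ?I])
    fix k \<rho>' \<mu>' assume I: "?I (Suc k) \<rho>' \<mu>'"
    have "balanced_mem (Suc (Suc (Suc k))) = (if Suc k \<le> l then m + input_mem (Suc (Suc (Suc k)))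
        else m - input_mem (Suc (Suc (Suc k))))"
      using I by (auto simp: balanced_mem_def)
    moreover have "(if 2 + k < p then balanced_mem p else input_mem p) =
        ((\<lambda>p. if 2 + Suc k < p then balanced_mem p else input_mem p)
          (Suc (Suc (Suc k)) := balanced_mem (Suc (Suc (Suc k))))) p" for p
      by auto
    ultimately show "runs (Cond (Minus (Reg rX) (Mem (Const 0)))
       (Store (Plus (Const 2) (Reg rX)) (Minus (Reg rM) (Mem (Plus (Const 2) (Reg rX)))))
       (Store (Plus (Const 2) (Reg rX)) (Plus (Reg rM) (Mem (Plus (Const 2) (Reg rX)))))) \<rho>' \<mu>' 18
       (\<lambda>\<rho>' \<mu>'. \<rho>' rX = Suc k \<and> ?I k (\<rho>'(rX := k)) \<mu>')"
      using I by (intro runs_Cond[where T' = 12]) (auto simp: regs_ready_def input_mem_simps fun_eq_iff)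
  next
    show "?I n (\<rho>(rX := n)) input_mem"
      using regs by (auto simp: balanced_mem_def fun_eq_iff)
  next
    fix \<rho>' \<mu>' assume "?I 0 \<rho>' \<mu>'"
    thus "regs_ready \<rho>' \<and> \<mu>' = balanced_mem"
      by (auto simp: balanced_mem_def fun_eq_iff)
  qed (use T' in auto)
  have "\<rho> rN = n" using regs by (simp add: regs_ready_def)
  thus ?thesis
    using T by (auto simp: init_balances_def intro!: loop)
qed

definition init_balance :: "nat \<Rightarrow> nat" where
  "init_balance x = (if x \<le> l then m + c x else m - a (x - l))"

lemma grid_balanced_mem: "grid balanced_mem init_balance (\<lambda>_. 0) (\<lambda>_ _. False)"
proof -
  have "balanced_mem (2 + x) = init_balance x" if "x \<in> {1..n}" for x
  proof (cases "x \<le> l")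
    case True
    thus ?thesis
      using that input_mem_simps(4)[of x] by (simp add: balanced_mem_def init_balance_def)
  next
    case False
    hence "x - l \<in> {1..r}" "2 + (l + (x - l)) = 2 + x" using that by auto
    hence "input_mem (2 + x) = a (x - l)"
      using input_mem_simps(5) by metis
    thus ?thesis
      using that False by (simp add: balanced_mem_def init_balance_def)
  qed
  moreover have "balanced_mem (cell x y) = 0" for x y
    using input_mem_simps(8)[of "cell x y"] by (auto simp: balanced_mem_def cell_def base_def)
  moreover have "balanced_mem 0 = l"
    by (simp add: balanced_mem_def input_mem_simps)
  ultimately show ?thesis by (simp add: grid_def)
qed

lemma edge_range:
  assumes "(i, j) \<in> set es"
  shows "i \<in> {1..l}" "j \<in> {1..r}"
proof -
  have "(U i, V j) \<in> E" using assms edge_set_es by (force simp: edge_set_def)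
  thus "i \<in> {1..l}" "j \<in> {1..r}" by (auto elim!: E_elim)
qed

lemma residual_empty_iff:
  assumes "x \<in> {1..n}" "y \<in> {1..n}"
  shows "residual {} (vtx x) (vtx y) \<longleftrightarrow> (\<exists>(i, j)\<in>set es. x = i \<and> y = l + j)"
proof
  assume "residual {} (vtx x) (vtx y)"
  then obtain i j where ij: "(i, j) \<in> set es" "vtx x = U i" "vtx y = V j"
    using edge_set_es by (auto simp: residual_def edge_set_def)
  hence "x = i" "y = l + j"
    using edge_range[OF ij(1)] by (auto simp: vtx_def split: if_splits)
  thus "\<exists>(i, j)\<in>set es. x = i \<and> y = l + j" using ij by blast
next
  assume "\<exists>(i, j)\<in>set es. x = i \<and> y = l + j"
  then obtain i j where ij: "(i, j) \<in> set es" "x = i" "y = l + j" by blast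
  have "(U i, V j) \<in> E" using ij edge_set_es by (force simp: edge_set_def)
  thus "residual {} (vtx x) (vtx y)"
    using edge_range[OF ij(1)] by (auto simp: residual_def vtx_def ij)
qed

lemma runs_load_edges:
  assumes regs: "regs_ready \<rho>" and T: "10 + m * (60 + 10 * n) \<le> T"
  shows "runs load_edges \<rho> balanced_mem T (\<lambda>\<rho>' \<mu>'. regs_ready \<rho>' \<and>
    grid \<mu>' init_balance (\<lambda>_. 0) (\<lambda>x y. residual {} (vtx x) (vtx y)))"
proof -
  \<comment> \<open>Edges are read from the end of the list, so what has been entered when k edges
    remain is the suffix \<open>drop k es\<close>. The invariant \<open>I\<close> also fixes all
    cells below \<open>base\<close>, since the unread edges are stored there.\<close>
  define R where "R k x y \<longleftrightarrow> (\<exists>(i, j)\<in>set (drop k es). x = i \<and> y = l + j)" for k x y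
  define I where "I k \<rho>' \<mu>' \<longleftrightarrow> k \<le> m \<and> regs_ready \<rho>' \<and> \<rho>' rK = k \<and>
    (\<forall>p<base. \<mu>' p = balanced_mem p) \<and> grid \<mu>' init_balance (\<lambda>_. 0) (R k)" for k \<rho>' \<mu>'
  let ?addr = "\<lambda>q. Plus (Reg rN) (Plus (Plus (Reg rK) (Reg rK)) (Const q))"
  let ?body = "row (Mem (?addr 1)) ;;
    Store (Plus (Reg rP) (Plus (Mem (Const 0)) (Mem (?addr 2)))) (Const 1)"
  have loop: "runs (countdown rK ?body) (\<rho>(rK := m)) balanced_mem T' (\<lambda>\<rho>' \<mu>'. regs_ready \<rho>' \<and>
      grid \<mu>' init_balance (\<lambda>_. 0) (\<lambda>x y. residual {} (vtx x) (vtx y)))"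
    if T': "2 + m * (60 + 10 * n) \<le> T'" for T'
  proof (rule runs_countdown[where k = m and Tb = "40 + 10 * n" and I = I])
    fix k \<rho>' \<mu>' assume I: "I (Suc k) \<rho>' \<mu>'"
    hence k: "k < m" and regs': "regs_ready \<rho>'" and K: "\<rho>' rK = Suc k"
      and low: "\<And>p. p < base \<Longrightarrow> \<mu>' p = balanced_mem p"
      and grid: "grid \<mu>' init_balance (\<lambda>_. 0) (R (Suc k))"
      by (auto simp: I_def)
    obtain i j where ij: "es ! k = (i, j)" by fastforce
    hence mem: "(i, j) \<in> set es" using k nth_mem by metis
    note range = edge_range[OF mem]
    have at: "\<mu>' (n + (Suc k + Suc k + 1)) = i" "\<mu>' (n + (Suc k + Suc k + 2)) = j"
    proof -
      have eq: "n + (Suc k + Suc k + 1) = 3 + n + 2 * k" "n + (Suc k + Suc k + 2) = 4 + n + 2 * k" by auto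
      have "\<mu>' p = input_mem p" if "2 + n < p" "p < base" for p
        using that low by (simp add: balanced_mem_def)
      thus "\<mu>' (n + (Suc k + Suc k + 1)) = i" "\<mu>' (n + (Suc k + Suc k + 2)) = j"
        using k input_mem_simps(6,7)[OF k] ij unfolding eq by (auto simp: base_def)
    qed
    define \<rho>1 where "\<rho>1 = \<rho>'(rP := base + i * Suc n, rX := 0)"
    have drop: "drop k es = (i, j) # drop (Suc k) es"
      using k ij by (metis Cons_nth_drop_Suc)
    show "runs ?body \<rho>' \<mu>' (40 + 10 * n) (\<lambda>\<rho>' \<mu>'. \<rho>' rK = Suc k \<and> I k (\<rho>'(rK := k)) \<mu>')"
    proof (rule runs_Seq[where P = "\<lambda>\<rho>'' \<mu>''. \<rho>'' = \<rho>1 \<and> \<mu>'' = \<mu>'"])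
      show "runs (row (Mem (?addr 1))) \<rho>' \<mu>' (20 + 10 * n) (\<lambda>\<rho>'' \<mu>''. \<rho>'' = \<rho>1 \<and> \<mu>'' = \<mu>')"
        using regs' K at range
        by (intro runs_row[where v = i and n = n]) (auto simp: \<rho>1_def regs_ready_def)
    next
      fix \<rho>'' \<mu>'' assume eq: "\<rho>'' = \<rho>1 \<and> \<mu>'' = \<mu>'"
      have addr: "\<rho>1 rP + (\<mu>' 0 + \<mu>' (\<rho>1 rN + (\<rho>1 rK + \<rho>1 rK + 2))) = cell i (l + j)"
        using regs' K at grid by (simp add: \<rho>1_def regs_ready_def cell_def grid_def)
      have "grid (\<mu>'(cell i (l + j) := of_bool True)) init_balance (\<lambda>_. 0) (R k)"
        by (rule grid_cong[OF grid_upd(3)[OF grid, of i "l + j"]])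
          (use range in \<open>auto simp: R_def drop\<close>)
      moreover have "base \<le> cell i (l + j)" by (simp add: cell_def)
      ultimately have "I k (\<rho>1(rK := k)) (\<mu>'(cell i (l + j) := 1))"
        unfolding I_def using k regs' low by (auto simp: \<rho>1_def)
      moreover have "\<rho>1 rK = Suc k" using K by (simp add: \<rho>1_def)
      ultimately show "runs (Store (Plus (Reg rP) (Plus (Mem (Const 0)) (Mem (?addr 2)))) (Const 1)) \<rho>'' \<mu>'' 20
          (\<lambda>\<rho>' \<mu>'. \<rho>' rK = Suc k \<and> I k (\<rho>'(rK := k)) \<mu>')"
        using eq addr by simp
    qed simp
  next
    show "I m (\<rho>(rK := m)) balanced_mem"
    proof -
      have "R m = (\<lambda>_ _. False)" by (auto simp: R_def fun_eq_iff)
      thus ?thesis using regs grid_balanced_mem by (auto simp: I_def)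
    qed
  next
    fix \<rho>' \<mu>' assume I: "I 0 \<rho>' \<mu>'"
    hence "grid \<mu>' init_balance (\<lambda>_. 0) (R 0)" by (simp add: I_def)
    hence "grid \<mu>' init_balance (\<lambda>_. 0) (\<lambda>x y. residual {} (vtx x) (vtx y))"
      by (rule grid_cong) (auto simp: R_def residual_empty_iff)
    thus "regs_ready \<rho>' \<and> grid \<mu>' init_balance (\<lambda>_. 0) (\<lambda>x y. residual {} (vtx x) (vtx y))"
      using I by (simp add: I_def)
  next
    show "2 + m * (40 + 10 * n + 6) \<le> T'"
      using T' by (auto simp: algebra_simps)
  qed (auto simp: I_def)
  have "\<rho> rM = m" using regs by (simp add: regs_ready_def)
  thus ?thesis
    using T by (auto simp: load_edges_def simp del: One_nat_def intro!: loop)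
qed

text \<open>Ensures \<open>a j\<close> <= m, so that the truncated subtraction m -
  \<open>a j\<close> in the initial balances is exact. The total of the \<open>a j\<close> equals
  that of the \<open>c i\<close>, which the out-degrees dominate.\<close>

lemma sum_a_le: "(\<Sum>j=1..r. a j) \<le> card E"
proof -
  have "(\<Sum>i=1..l. c i) \<le> (\<Sum>i=1..l. out_deg E (U i))"
    using out_deg_ge by (intro sum_mono) auto
  also have "real (\<Sum>i=1..l. out_deg E (U i)) = real (card E)"
    using sum_fst[of "\<lambda>_. 1" UNIV] out_deg_sum[OF subset_refl] by (simp del: atLeastAtMost_iff)
  hence "(\<Sum>i=1..l. out_deg E (U i)) = card E" by linarith
  finally show ?thesis using sum_eq by simp
qed

lemma init_balance_eq:
  assumes "x \<in> {1..n}"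
  shows "int (init_balance x) = int m + excess c a {} (vtx x)"
proof (cases "x \<le> l")
  case False
  hence "a (x - l) \<le> (\<Sum>j=1..r. a j)"
    using assms by (intro member_le_sum) auto
  hence "a (x - l) \<le> m" using sum_a_le m_eq by simp
  thus ?thesis
    using False by (simp add: init_balance_def vtx_def excess_def in_deg_def)
qed (simp add: init_balance_def vtx_def excess_def out_deg_def)

section \<open>The complete program and its time bound\<close>

lemma card_pos:
  assumes "E \<noteq> {}"
  shows "1 \<le> m" "2 \<le> n"
proof -
  obtain e where "e \<in> E" using assms by blast
  then obtain i j where "i \<in> {1..l}" "j \<in> {1..r}" by (rule E_elim)
  thus "2 \<le> n" by simp
  show "1 \<le> m" using assms m_eq finite_E by (simp add: Suc_le_eq card_gt_0_iff)
qed

lemma runs_discrepancy_com_nonempty: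
  assumes E: "E \<noteq> {}"
  shows "runs discrepancy_com (\<lambda>_. 0) input_mem (2000 * (m * n ^ 2))
    (\<lambda>\<rho>' \<mu>'. \<exists>F S. cut_certificate l r E c a F S \<and> int (\<rho>' 0) = 2 * total_excess l r c a F)"
    (is "runs _ _ _ _ ?Q")
proof -
  have sum: "runs sum_excess \<rho> \<mu> (10 + 20 * n) ?Q"
    if "regs_ready \<rho> \<and> (\<exists>F d. represents \<mu> F d \<and> valid_labelling F d \<and>
      (\<forall>x\<in>{1..n}. 0 < excess c a F (vtx x) \<longrightarrow> n \<le> d (vtx x)))" for \<rho> \<mu>
  proof -
    from that obtain F d where regs: "regs_ready \<rho>" and rep: "represents \<mu> F d"
      and inv: "valid_labelling F d" and final: "\<forall>x\<in>{1..n}. 0 < excess c a F (vtx x) \<longrightarrow> n \<le> d (vtx x)"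
      by blast
    have "n \<le> d v" if "v \<in> verts" "0 < excess c a F v" for v
      using verts_vtx[OF that(1)] that(2) final by blast
    then obtain S where "cut_certificate l r E c a F S"
      using valid_labelling_certificate[OF inv] by blast
    thus ?thesis
      by (intro runs_mono[OF runs_sum_excess[OF regs rep le_refl] le_refl]) blast
  qed
  have main: "runs (main_loop ;; sum_excess) \<rho> \<mu> (20 + 20 * n + (2 + 3 * n * m) * (120 + 80 * n)) ?Q"
    if "regs_ready \<rho> \<and> grid \<mu> init_balance (\<lambda>_. 0) (\<lambda>x y. residual {} (vtx x) (vtx y))" for \<rho> \<mu>
  proof (rule runs_Seq[OF runs_main_loop[OF _ _ le_refl] sum])
    show "represents \<mu> {} (\<lambda>_. 0)"
      unfolding represents_def using that init_balance_eq by blast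
  qed (use that in auto)
  have all: "runs (prepare ;; init_balances ;; load_edges ;; main_loop ;; sum_excess) (\<lambda>_. 0) input_mem
      (30 + (10 + 30 * n + (10 + m * (60 + 10 * n) + (20 + 20 * n + (2 + 3 * n * m) * (120 + 80 * n))))) ?Q"
    by (rule runs_Seq[OF runs_prepare[OF le_refl] _ le_refl],
      elim conjE, hypsubst, rule runs_Seq[OF runs_init_balances[OF _ le_refl] _ le_refl], assumption,
      elim conjE, hypsubst, rule runs_Seq[OF runs_load_edges[OF _ le_refl] main le_refl])
  \<comment> \<open>Once there is an edge, every monomial of the time bound is at most m n^2. The
    coefficients add up to 1196, well below 2000.\<close>
  have "1 \<le> m * n\<^sup>2" "n \<le> m * n\<^sup>2" "m \<le> m * n\<^sup>2" "m * n \<le> m * n\<^sup>2"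
    using card_pos[OF E] by (auto simp: power2_eq_square Suc_le_eq)
  hence "36 + (10 + 30 * n + (10 + m * (60 + 10 * n) + (20 + 20 * n + (2 + 3 * n * m) * (120 + 80 * n))))
      \<le> 2000 * (m * n\<^sup>2)"
    by (simp add: algebra_simps power2_eq_square)
  moreover have "input_mem 2 \<noteq> 0"
    unfolding input_mem_simps(3) using card_pos[OF E] by linarith
  ultimately show ?thesis
    unfolding discrepancy_com_def
    by (intro runs_Cond[OF all]) (auto simp: input_mem_simps)
qed

text \<open>Out-degrees 0 force all \<open>c i\<close> to be 0, so the empty F has no positive
  excess and the empty S is a certificate.\<close>

lemma runs_discrepancy_com_empty:
  assumes "E = {}"
  shows "runs discrepancy_com (\<lambda>_. 0) input_mem 10
    (\<lambda>\<rho>' \<mu>'. \<exists>F S. cut_certificate l r E c a F S \<and> int (\<rho>' 0) = 2 * total_excess l r c a F)"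
proof -
  have c0: "c i = 0" if "i \<in> {1..l}" for i
    using out_deg_ge that assms by (auto simp: out_deg_def)
  have "excess c a {} v \<le> 0" if "v \<in> verts" for v
    using that c0 by (auto simp: left_vertices_def right_vertices_def excess_def in_deg_def)
  hence "cut_certificate l r E c a {} {}" "total_excess l r c a {} = 0"
    by (auto simp: cut_certificate_def out_deg_def total_excess_def not_less intro!: sum.neutral max_absorb1)
  hence "\<exists>F S. cut_certificate l r E c a F S \<and> int 0 = 2 * total_excess l r c a F"
    by (intro exI[of _ "{}"]) simp
  moreover have "input_mem 2 = 0"
    using input_mem_simps(3) m_eq assms by (metis card.empty)
  ultimately show ?thesis
    unfolding discrepancy_com_def by (intro runs_Cond[where T' = 1]) auto
qed

lemma discrepancy_com_correct:
  "\<exists>t s F S. exec discrepancy_com (initial_state (input_list l r es c a)) t s \<and>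
    cut_certificate l r E c a F S \<and> int (result s) = 2 * total_excess l r c a F \<and>
    real t \<le> 4000 * (1 + real (card E) * real (card verts) ^ 2 * ln (real (card verts)))"
proof -
  have init: "initial_state (input_list l r es c a) = (\<lambda>_. 0, input_mem)"
    by (simp add: input_mem_def initial_state_def)
  show ?thesis
  proof (cases "E = {}")
    case True
    thus ?thesis
      using runs_discrepancy_com_empty unfolding runs_def init result_def by force
  next
    case False
    then obtain t \<rho> \<mu> F S where t: "exec discrepancy_com (\<lambda>_. 0, input_mem) t (\<rho>, \<mu>)" "t \<le> 2000 * (m * n\<^sup>2)"
      "cut_certificate l r E c a F S" "int (\<rho> 0) = 2 * total_excess l r c a F"
      using runs_discrepancy_com_nonempty unfolding runs_def by blast
    \<comment> \<open>An edge has an endpoint on each side, so n >= 2 and the logarithm is at least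
      ln 2 >= 1/2. This is what doubles 2000 to 4000.\<close>
    have "1 / 2 \<le> ln (2 :: real)" using ln_le_minus_one[of "1 / 2 :: real"] by (simp add: ln_div)
    also have "\<dots> \<le> ln (real n)" using card_pos[OF False] by simp
    finally have "1 / 2 \<le> ln (real n)" .
    hence "real (m * n\<^sup>2) * (1 / 2) \<le> real (m * n\<^sup>2) * ln (real n)"
      by (intro mult_left_mono) auto
    moreover have "real t \<le> real (2000 * (m * n\<^sup>2))"
      using t(2) by (rule of_nat_mono)
    ultimately have "real t \<le> 4000 * (1 + real (card E) * real (card verts) ^ 2 * ln (real (card verts)))"
      unfolding card_verts m_eq[symmetric] by simp
    thus ?thesis
      unfolding init result_def using t(1,3,4) by force
  qed
qed

end

theorem theorem1:
  "(\<forall>l r E c a. discrepancy_instance l r E c a \<longrightarrow>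
      is_min_flow_cost (discrepancy_network l r E c a) (of_int (min_discrepancy l r E c a))) \<and>
   (\<exists>p C. \<forall>l r E c a es.
      discrepancy_instance l r E c a \<longrightarrow> distinct es \<longrightarrow> edge_set es = E \<longrightarrow>
      (\<exists>t s. exec p (initial_state (input_list l r es c a)) t s \<and>
        is_min_flow_cost (discrepancy_network l r E c a) (real (result s)) \<and>
        real t \<le> C * (1 + real (card E) * real (card (left_vertices l \<union> right_vertices r)) ^ 2
                        * ln (real (card (left_vertices l \<union> right_vertices r))))))"
proof (intro conjI allI impI)
  fix l r E c a assume inst: "discrepancy_instance l r E c a"
  then interpret discrepancy_instance l r E c a .
  \<comment> \<open>The first claim mentions no edge list, so one is chosen by enumerating
    E.\<close>
  have "finite ((\<lambda>e. (case fst e of U i \<Rightarrow> i | V j \<Rightarrow> j, case snd e of U i \<Rightarrow> i | V j \<Rightarrow> j)) ` E)"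
    using finite_E by simp
  then obtain es where es: "distinct es"
    "set es = (\<lambda>e. (case fst e of U i \<Rightarrow> i | V j \<Rightarrow> j, case snd e of U i \<Rightarrow> i | V j \<Rightarrow> j)) ` E"
    using finite_distinct_list by metis
  have "edge_set es = E"
  proof -
    have "edge_set es = (\<lambda>e. e) ` E"
      unfolding edge_set_def es(2) image_image by (rule image_cong) (auto elim!: E_elim)
    thus ?thesis by simp
  qed
  then interpret discrepancy_input l r E c a es
    by unfold_locales (rule es)
  \<comment> \<open>The halting run of the program is itself the existence proof of a certificate;
    no separate max-flow min-cut argument is made.\<close>
  obtain F S where "cut_certificate l r E c a F S"
    using discrepancy_com_correct by blast
  from cut_certificate_optimal[OF this] show
    "is_min_flow_cost (discrepancy_network l r E c a) (of_int (min_discrepancy l r E c a))"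
    by simp
next
  show "\<exists>p C. \<forall>l r E c a es.
      discrepancy_instance l r E c a \<longrightarrow> distinct es \<longrightarrow> edge_set es = E \<longrightarrow>
      (\<exists>t s. exec p (initial_state (input_list l r es c a)) t s \<and>
        is_min_flow_cost (discrepancy_network l r E c a) (real (result s)) \<and>
        real t \<le> C * (1 + real (card E) * real (card (left_vertices l \<union> right_vertices r)) ^ 2
                        * ln (real (card (left_vertices l \<union> right_vertices r)))))"
  proof (rule exI[of _ discrepancy_com], rule exI[of _ 4000], intro allI impI)
    fix l r E c a es
    assume "discrepancy_instance l r E c a" and es: "distinct es" "edge_set es = E"
    then interpret discrepancy_instance l r E c a by simp
    interpret discrepancy_input l r E c a es
      by unfold_locales (rule es)+
    obtain t s F S where *: "exec discrepancy_com (initial_state (input_list l r es c a)) t s"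
      "cut_certificate l r E c a F S" "int (result s) = 2 * total_excess l r c a F"
      "real t \<le> 4000 * (1 + real (card E) * real (card verts) ^ 2 * ln (real (card verts)))"
      using discrepancy_com_correct by blast
    have "real (result s) = of_int (2 * total_excess l r c a F)"
      using *(3) by (metis of_int_of_nat_eq)
    thus "\<exists>t s. exec discrepancy_com (initial_state (input_list l r es c a)) t s \<and>
        is_min_flow_cost (discrepancy_network l r E c a) (real (result s)) \<and>
        real t \<le> 4000 * (1 + real (card E) * real (card (left_vertices l \<union> right_vertices r)) ^ 2
                        * ln (real (card (left_vertices l \<union> right_vertices r))))"
      using * cut_certificate_optimal(2)[OF *(2)] by metis
  qed
qed

end
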